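(* Assume the standing setting described in the context, in either case (a) or case (b). In case (a), and in case (b) for every sufficiently small $\varepsilon>0$, there exist $\delta>0$ and $c_0,c_1,c_2>0$ such that for every solution $x$ of system (S) and every $t\ge 0$ with $\|x_t\|_h\le\delta$, the time derivative of $t\mapsto v(t,x_t)$ along the solution satisfies $$\frac{d v(t,x_t)}{dt}\le -c_0\|x(t)\|^{\gamma+\mu-1}-c_1\|x(t-h)\|^{\gamma+\mu-1}-c_2\int_{-h}^0\|x(t+\theta)\|^{\gamma+\mu-1}\,d\theta .$$
   Context: Standing setting. Fix $n\ge1$ and a delay $h>0$. $\|\cdot\|$ is the Euclidean norm on $\mathbb R^n$ (and the induced operator norm on matrices). $C_{[-h,0]}$ is the space of continuous $\varphi:[-h,0]\to\mathbb R^n$ with norm $\|\varphi\|_h=\max_{\theta\in[-h,0]}\|\varphi(\theta)\|$. Consider system (S): $\dot x(t)=f(x(t),x(t-h))+B(t)Q(x(t),x(t-h))$, $t\ge0$, with initial function $\varphi\in C_{[-h,0]}$; $x(t,\varphi)$ denotes its solution and $x_t\in C_{[-h,0]}$ is the state $x_t(\theta)=x(t+\theta)$, $\theta\in[-h,0]$. Assumptions: (i) $f:\mathbb R^n\times\mathbb R^n\to\mathbb R^n$ is Lipschitz, continuously differentiable in both arguments, and homogeneous of degree $\mu>1$: $f(c\mathrm x_1,c\mathrm x_2)=c^\mu f(\mathrm x_1,\mathrm x_2)$ for all $c>0$; constants $m_1,m_2,\eta_{11},\eta_{12}\ge0$ are such that $\|f(\mathrm x_1,\mathrm x_2)\|\le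 m_1\|\mathrm x_1\|^\mu+m_2\|\mathrm x_2\|^\mu$ and $\|\partial f/\partial \mathrm x_1(\mathrm x_1,\mathrm x_2)\|\le \eta_{11}\|\mathrm x_1\|^{\mu-1}+\eta_{12}\|\mathrm x_2\|^{\mu-1}$. (ii) $B:[0,\infty)\to\mathbb R^{n\times n}$ is continuous with $\|B(t)\|\le\hat b$ for all $t$. (iii) $Q:\mathbb R^n\times\mathbb R^n\to\mathbb R^n$ is continuously differentiable and, for some $\sigma>1$ and constants $p_1,p_2,q_{jk}\ge0$, $\|Q(\mathrm x_1,\mathrm x_2)\|\le p_1\|\mathrm x_1\|^\sigma+p_2\|\mathrm x_2\|^\sigma$ and $\|\partial Q/\partial\mathrm x_j(\mathrm x_1,\mathrm x_2)\|\le q_{j1}\|\mathrm x_1\|^{\sigma-1}+q_{j2}\|\mathrm x_2\|^{\sigma-1}$, $j=1,2$. (iv) The delay-free system $\dot x=f(x,x)$ is asymptotically stable, and $V:\mathbb R^n\to\mathbb R$ is a positive definite, twice continuously differentiable function, homogeneous of degree $\gamma\ge2$, with constants $\mathrm w,\alpha_0,\alpha_1,\beta,\psi>0$ such that $(\partial V/\partial\mathrm x)^T f(\mathrm x,\mathrm x)\le-\mathrm w\|\mathrm x\|^{\gamma+\mu-1}$, $\alpha_0\|\mathrm x\|^\gamma\le V(\mathrm x)\le\alpha_1\|\mathrm x\|^\gamma$, $\|\partial V/\partial\mathrm x\|\le\beta\|\mathrm x\|^{\gamma-1}$, $\|\partial^2V/\partial\mathrm x^2\|\le\psi\|\mathrm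 x\|^{\gamma-2}$. Perturbation classes: case (a): $\int_0^tB(s)\,ds$ is bounded on $t\ge0$ and $\sigma>(\mu+1)/2$; case (b): $\frac1T\int_t^{t+T}B(s)\,ds\to0$ as $T\to+\infty$ uniformly in $t\ge0$, and $\sigma\ge\mu$. Define $L(t,\varepsilon)=\int_0^{t+h}e^{-\varepsilon(t+h-s)}B(s)\,ds$, where $\varepsilon=0$ in case (a) and $\varepsilon>0$ is a parameter in case (b). In case (b), $\omega(\varepsilon):=\sup_{t\ge0}\varepsilon\|L(t,\varepsilon)\|$ is finite and $\omega(\varepsilon)\to0$ as $\varepsilon\to0$. In case (a) let $l_0>0$ with $\|L(t,0)\|\le l_0$ for all $t\ge0$, and throughout read $\omega(\varepsilon)$ as $0$ and $\omega(\varepsilon)/\varepsilon$ as $l_0$. Fix $\mathrm w_1,\mathrm w_2>0$ with $\mathrm w_0:=\mathrm w-\mathrm w_1-h\mathrm w_2>0$. The functional $v:[0,\infty)\times C_{[-h,0]}\to\mathbb R$ is $v(t,\varphi)=V(\varphi(0))+\Big(\frac{\partial V}{\partial\mathrm x}(\varphi(0))\Big)^T\Big(\int_{-h}^0\big(f(\varphi(0),\varphi(\theta))+B(t+\theta+h)Q(\varphi(0),\varphi(\theta))\big)d\theta-L(t,\varepsilon)Q(\varphi(0),\varphi(0))\Big)+\int_{-h}^0(\mathrm w_1+(h+\theta)\mathrm w_2)\|\varphi(\theta)\|^{\gamma+\mu-1}d\theta.$ For $\alpha>1$, $S_\alpha=\{\varphi\in C_{[-h,0]}:\|\varphi(\theta)\|\le\alpha\|\varphi(0)\|\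 \forall\theta\in[-h,0]\}$. Notation: $m=m_1+m_2$, $p=p_1+p_2$. *)

theory Defs
  imports "HOL-Analysis.Analysis"
begin

text \<open>A solution of system (S) on [-h, infinity): continuous on [-h, infinity) (its restriction
to [-h,0] is the initial function), and satisfying the delay equation for t >= 0
(one-sided derivative at t = 0).\<close>
definition is_solution ::
  "real \<Rightarrow> (real^'n \<Rightarrow> real^'n \<Rightarrow> real^'n) \<Rightarrow> (real \<Rightarrow> real^'n^'n)
   \<Rightarrow> (real^'n \<Rightarrow> real^'n \<Rightarrow> real^'n) \<Rightarrow> (real \<Rightarrow> real^'n) \<Rightarrow> bool" where
  "is_solution h f B Q x \<longleftrightarrow>
     continuous_on {-h..} x \<and>
     (\<forall>t\<ge>0. (x has_vector_derivative (f (x t) (x (t - h)) + B t *v Q (x t) (x (t - h))))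
               (at t within {0..}))"

text \<open>The state x_t.\<close>
definition state :: "(real \<Rightarrow> real^'n) \<Rightarrow> real \<Rightarrow> real \<Rightarrow> real^'n" where
  "state x t = (\<lambda>\<theta>. x (t + \<theta>))"

text \<open>L(t,eps) = integral from 0 to t+h of exp(-eps(t+h-s)) B(s) ds.\<close>
definition Lmat :: "real \<Rightarrow> (real \<Rightarrow> real^'n^'n) \<Rightarrow> real \<Rightarrow> real \<Rightarrow> real^'n^'n" where
  "Lmat h B \<epsilon> t = integral {0..t + h} (\<lambda>s. exp (- \<epsilon> * (t + h - s)) *\<^sub>R B s)"

text \<open>The Lyapunov--Krasovskii functional v(t, phi); V' is the gradient of V.\<close>
definition vfun ::
  "real \<Rightarrow> (real^'n \<Rightarrow> real^'n \<Rightarrow> real^'n) \<Rightarrow> (real \<Rightarrow> real^'n^'n)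
   \<Rightarrow> (real^'n \<Rightarrow> real^'n \<Rightarrow> real^'n) \<Rightarrow> (real^'n \<Rightarrow> real) \<Rightarrow> (real^'n \<Rightarrow> real^'n)
   \<Rightarrow> real \<Rightarrow> real \<Rightarrow> real \<Rightarrow> real \<Rightarrow> real \<Rightarrow> real \<Rightarrow> (real \<Rightarrow> real^'n) \<Rightarrow> real" where
  "vfun h f B Q V V' \<gamma> \<mu> w1 w2 \<epsilon> t \<phi> =
     V (\<phi> 0)
     + V' (\<phi> 0) \<bullet> (integral {-h..0} (\<lambda>\<theta>. f (\<phi> 0) (\<phi> \<theta>) + B (t + \<theta> + h) *v Q (\<phi> 0) (\<phi> \<theta>))
                     - Lmat h B \<epsilon> t *v Q (\<phi> 0) (\<phi> 0))
     + integral {-h..0} (\<lambda>\<theta>. (w1 + (h + \<theta>) * w2) * norm (\<phi> \<theta>) powr (\<gamma> + \<mu> - 1))"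

text \<open>Conclusion of the lemma for a given value of the parameter eps.\<close>
definition derivative_estimate ::
  "real \<Rightarrow> (real^'n \<Rightarrow> real^'n \<Rightarrow> real^'n) \<Rightarrow> (real \<Rightarrow> real^'n^'n)
   \<Rightarrow> (real^'n \<Rightarrow> real^'n \<Rightarrow> real^'n) \<Rightarrow> (real^'n \<Rightarrow> real) \<Rightarrow> (real^'n \<Rightarrow> real^'n)
   \<Rightarrow> real \<Rightarrow> real \<Rightarrow> real \<Rightarrow> real \<Rightarrow> real \<Rightarrow> bool" where
  "derivative_estimate h f B Q V V' \<gamma> \<mu> w1 w2 \<epsilon> \<longleftrightarrow>
     (\<exists>\<delta>>0. \<exists>c0>0. \<exists>c1>0. \<exists>c2>0.
       \<forall>x t D. is_solution h f B Q x \<and> t \<ge> 0 \<and>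
               (\<forall>\<theta>\<in>{-h..0}. norm (x (t + \<theta>)) \<le> \<delta>) \<and>
               ((\<lambda>s. vfun h f B Q V V' \<gamma> \<mu> w1 w2 \<epsilon> s (state x s)) has_real_derivative D)
                  (at t within {0..})
         \<longrightarrow> D \<le> - c0 * norm (x t) powr (\<gamma> + \<mu> - 1)
                  - c1 * norm (x (t - h)) powr (\<gamma> + \<mu> - 1)
                  - c2 * integral {-h..0} (\<lambda>\<theta>. norm (x (t + \<theta>)) powr (\<gamma> + \<mu> - 1)))"

end

theory Submission
  imports Defs
begin

(* Differentiating v along a solution, the window integral in the correction term contributes
   V'(x(t)) (f(x(t),x(t)) + B(t+h) Q(x(t),x(t)) - x'(t)) and the kernel L contributes
   -V'(x(t)) (B(t+h) - \<epsilon> L) Q(x(t),x(t)); so V'(x(t)) x'(t) cancels and at the leading order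
   K = \<gamma> + \<mu> - 1 only V'(x) f(x,x) \<le> -w |x|^K survives, while the weights w1, w2 produce
   -w1 |x(t-h)|^K - w2 \<integral> |x(t+\<theta>)|^K.  Every other term has order K + (2 min(\<mu>,\<sigma>) - \<mu> - 1),
   hence is a small multiple of |x(t)|^K + |x(t-h)|^K + \<integral> |x(t+\<theta>)|^K once the state is
   \<delta>-small, except \<epsilon> V'(x) L Q(x,x), of order \<gamma> - 1 + \<sigma> \<ge> K, which is controlled by
   \<epsilon> |L|: it vanishes in case (a), and in case (b) it tends to 0 with \<epsilon> because B has small
   long-time averages (integrate by parts against the exponential kernel). *)

section \<open>Derivatives of sliding-window integrals\<close>

lemma has_vector_derivative_integral_upper:
  fixes g :: "real \<Rightarrow> 'a::banach"
  assumes "continuous_on {c..} g" "c \<le> t"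
  shows "((\<lambda>s. integral {c..s} g) has_vector_derivative g t) (at t within {c..})"
proof -
  have "continuous_on {c..t+1} g" using assms(1) by (rule continuous_on_subset) auto
  then have "((\<lambda>s. integral {c..s} g) has_vector_derivative g t) (at t within {c..t+1})"
    using assms(2) by (intro integral_has_vector_derivative) auto
  moreover have "at t within {c..t+1} = at t within {c..}"
    by (rule at_within_nhd[where S="{t-1<..<t+1}"]) auto
  ultimately show ?thesis by simp
qed

lemma has_vector_derivative_shift:
  fixes F :: "real \<Rightarrow> 'a::real_normed_vector"
  assumes "(F has_vector_derivative F') (at (s + T) within {c + T..})"
  shows "((\<lambda>s. F (s + T)) has_vector_derivative F') (at s within {c..})"
proof -
  have "(\<lambda>s. s + T) ` {c..} = {c + T..}"
    using image_add_atLeast[of T c] by (simp add: add.commute)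
  then have "(F has_vector_derivative F') (at ((\<lambda>s. s + T) s) within (\<lambda>s. s + T) ` {c..})"
    using assms by simp
  moreover have "((\<lambda>s. s + T) has_vector_derivative 1) (at s within {c..})"
    by (auto intro!: derivative_eq_intros)
  ultimately show ?thesis
    using vector_diff_chain_within by (fastforce simp: o_def)
qed

lemma continuous_on_if_has_vector_derivative:
  fixes F :: "real \<Rightarrow> 'a::real_normed_vector"
  assumes "\<And>s. s \<in> S \<Longrightarrow> (F has_vector_derivative F' s) (at s within S)"
  shows "continuous_on S F"
  by (rule has_derivative_continuous_on) (use assms in \<open>auto simp: has_vector_derivative_def\<close>)

lemma has_vector_derivative_window_integral:
  fixes g :: "real \<Rightarrow> 'a::banach"
  assumes g: "continuous_on {-h..} g" and "h \<ge> 0" "t \<ge> 0"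
  shows "((\<lambda>s. integral {-h..0} (\<lambda>\<theta>. g (s + \<theta>))) has_vector_derivative g t - g (t - h))
           (at t within {0..})"
proof -
  define F where "F s = integral {-h..s} g" for s
  have window_eq: "integral {-h..0} (\<lambda>\<theta>. g (s + \<theta>)) = F s - F (s - h)" if "s \<ge> 0" for s
  proof -
    have "g integrable_on {-h..s}"
      by (rule integrable_continuous_interval, rule continuous_on_subset[OF g]) auto
    then have "integral {-h..s-h} g + integral {s-h..s} g = F s"
      unfolding F_def using Henstock_Kurzweil_Integration.integral_combine[of "-h" "s-h" s g]
        that \<open>h \<ge> 0\<close> by simp
    moreover have "integral {-h..0} (\<lambda>\<theta>. g (s + \<theta>)) = integral {s-h..s} g"
      using integral_shift_Icc_real[of "-h" 0 g s] by (simp add: o_def add.commute)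
    ultimately show ?thesis unfolding F_def by (simp add: algebra_simps)
  qed
  have "(F has_vector_derivative g t) (at t within {0..})"
    using has_vector_derivative_integral_upper[OF g, of t] assms unfolding F_def
    by (intro has_vector_derivative_within_subset[where S="{-h..}" and T="{0..}"]) auto
  moreover have "((\<lambda>s. F (s + - h)) has_vector_derivative g (t - h)) (at t within {0..})"
    using has_vector_derivative_integral_upper[OF g, of "t - h"] \<open>t \<ge> 0\<close>
    unfolding F_def by (intro has_vector_derivative_shift) simp
  ultimately have "((\<lambda>s. F s - F (s - h)) has_vector_derivative g t - g (t - h)) (at t within {0..})"
    by (auto intro: has_vector_derivative_diff)
  then show ?thesis
    by (rule has_vector_derivative_transform[rotated 2]) (use \<open>t \<ge> 0\<close> window_eq in auto)
qed

lemma continuous_on_window_integral_param: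
  fixes G :: "'a::topological_space \<Rightarrow> real \<Rightarrow> 'b::banach"
  assumes G_cont: "continuous_on (UNIV \<times> {-h..}) (\<lambda>p. G (fst p) (snd p))"
  shows "continuous_on ({0..} \<times> UNIV) (\<lambda>(s, a). integral {-h..0} (\<lambda>\<theta>. G a (s + \<theta>)))"
proof -
  let ?r = "\<lambda>q::(real \<times> 'a) \<times> real. (snd (fst q), fst (fst q) + snd q)"
  have c: "continuous_on (({0..} \<times> UNIV) \<times> {-h..0}) ?r"
    by (intro continuous_intros)
  have i: "?r ` (({0..} \<times> UNIV) \<times> {-h..0}) \<subseteq> UNIV \<times> {-h..}"
    by auto
  have "continuous_on (({0..} \<times> UNIV) \<times> cbox (-h) 0) (\<lambda>(p, \<theta>). G (snd p) (fst p + \<theta>))"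
    using continuous_on_compose2[OF G_cont c i] by (simp add: split_beta)
  from integral_continuous_on_param[OF this] show ?thesis
    by (simp add: split_beta)
qed

lemma has_derivative_window_integral_param:
  fixes g :: "real^'n \<Rightarrow> real \<Rightarrow> 'c::euclidean_space"
    and g' :: "real^'n \<Rightarrow> real \<Rightarrow> ((real^'n) \<Rightarrow>\<^sub>L 'c)"
  assumes g_cont: "\<And>a. continuous_on {-h..} (g a)"
    and g'_cont: "continuous_on (UNIV \<times> {-h..}) (\<lambda>p. g' (fst p) (snd p))"
    and g_deriv: "\<And>a u. u \<ge> -h \<Longrightarrow> ((\<lambda>a. g a u) has_derivative blinfun_apply (g' a u)) (at a)"
    and "s \<ge> 0"
  shows "((\<lambda>a. integral {-h..0} (\<lambda>\<theta>. g a (s + \<theta>))) has_derivative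
           blinfun_apply (integral {-h..0} (\<lambda>\<theta>. g' a (s + \<theta>)))) (at a)"
proof -
  have "((\<lambda>a. integral (cbox (-h) 0) (\<lambda>\<theta>. g a (s + \<theta>))) has_derivative
         blinfun_apply (integral (cbox (-h) 0) (\<lambda>\<theta>. g' a (s + \<theta>)))) (at a within UNIV)"
  proof (rule leibniz_rule[where fx="\<lambda>a \<theta>. g' a (s + \<theta>)"])
    show "((\<lambda>a. g a (s + \<theta>)) has_derivative blinfun_apply (g' a (s + \<theta>))) (at a within UNIV)"
      if "\<theta> \<in> cbox (-h) 0" for a \<theta> using that \<open>s \<ge> 0\<close> by (intro g_deriv) auto
    show "(\<lambda>\<theta>. g a (s + \<theta>)) integrable_on cbox (-h) 0" for a
    proof -
      have "continuous_on {-h..0} (\<lambda>\<theta>. g a (s + \<theta>))"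
        by (rule continuous_on_compose2[OF g_cont]) (use \<open>s \<ge> 0\<close> in \<open>auto intro!: continuous_intros\<close>)
      then show ?thesis by (simp add: integrable_continuous_interval)
    qed
    have c: "continuous_on (UNIV \<times> {-h..0}) (\<lambda>p. (fst p, s + snd p))"
      by (intro continuous_intros)
    have i: "(\<lambda>p. (fst p, s + snd p)) ` (UNIV \<times> {-h..0}) \<subseteq> UNIV \<times> {-h..}"
      using \<open>s \<ge> 0\<close> by auto
    show "continuous_on (UNIV \<times> cbox (-h) 0) (\<lambda>(a, \<theta>). g' a (s + \<theta>))"
      using continuous_on_compose2[OF g'_cont c i] by (simp add: split_beta)
  qed auto
  then show ?thesis by simp
qed

lemma has_vector_derivative_window_integral_param:
  fixes g :: "real^'n \<Rightarrow> real \<Rightarrow> 'c::euclidean_space"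
    and g' :: "real^'n \<Rightarrow> real \<Rightarrow> ((real^'n) \<Rightarrow>\<^sub>L 'c)"
  assumes g_cont: "continuous_on (UNIV \<times> {-h..}) (\<lambda>p. g (fst p) (snd p))"
    and g'_cont: "continuous_on (UNIV \<times> {-h..}) (\<lambda>p. g' (fst p) (snd p))"
    and g_deriv: "\<And>a u. u \<ge> -h \<Longrightarrow> ((\<lambda>a. g a u) has_derivative blinfun_apply (g' a u)) (at a)"
    and "h \<ge> 0" "t \<ge> 0"
    and x_deriv: "(x has_vector_derivative y) (at t within {0..})"
  shows "((\<lambda>s. integral {-h..0} (\<lambda>\<theta>. g (x s) (s + \<theta>))) has_vector_derivative
          g (x t) t - g (x t) (t - h) + blinfun_apply (integral {-h..0} (\<lambda>\<theta>. g' (x t) (t + \<theta>))) y)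
         (at t within {0..})"
proof -
  define \<Phi> where "\<Phi> s a = integral {-h..0} (\<lambda>\<theta>. g a (s + \<theta>))" for s a
  define \<Phi>' where "\<Phi>' s a = integral {-h..0} (\<lambda>\<theta>. g' a (s + \<theta>))" for s a
  have g_cont_at: "continuous_on {-h..} (g a)" for a
    by (rule continuous_on_compose2[OF g_cont, of _ "\<lambda>u. (a, u)", simplified])
      (auto intro!: continuous_intros)
  have "((\<lambda>s. \<Phi> s (x t)) has_derivative (\<lambda>d. d *\<^sub>R (g (x t) t - g (x t) (t - h))))
      (at t within {0..})"
    using has_vector_derivative_window_integral[OF g_cont_at \<open>h \<ge> 0\<close> \<open>t \<ge> 0\<close>]
    unfolding \<Phi>_def has_vector_derivative_def .
  moreover have "((\<lambda>a. \<Phi> s a) has_derivative blinfun_apply (\<Phi>' s a)) (at a within UNIV)"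
    if "s \<in> {0..}" for s a
    using has_derivative_window_integral_param[OF g_cont_at g'_cont g_deriv] that
    unfolding \<Phi>_def \<Phi>'_def by simp
  moreover have "continuous (at (t, x t) within {0..} \<times> UNIV) (\<lambda>(s, a). \<Phi>' s a)"
    using continuous_on_window_integral_param[OF g'_cont] \<open>t \<ge> 0\<close>
    unfolding \<Phi>'_def by (simp add: continuous_on_eq_continuous_within)
  ultimately have "((\<lambda>(s, a). \<Phi> s a) has_derivative
      (\<lambda>(ds, da). ds *\<^sub>R (g (x t) t - g (x t) (t - h)) + blinfun_apply (\<Phi>' t (x t)) da))
      (at (t, x t) within {0..} \<times> UNIV)"
    by (rule has_derivative_partialsI) auto
  then have "((\<lambda>(s, a). \<Phi> s a) has_derivative
      (\<lambda>(ds, da). ds *\<^sub>R (g (x t) t - g (x t) (t - h)) + blinfun_apply (\<Phi>' t (x t)) da))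
      (at ((\<lambda>s. (s, x s)) t) within (\<lambda>s. (s, x s)) ` {0..})"
    by (rule has_derivative_subset) auto
  moreover have "((\<lambda>s. (s, x s)) has_derivative (\<lambda>d. (d, d *\<^sub>R y))) (at t within {0..})"
    using x_deriv unfolding has_vector_derivative_def by (auto intro!: derivative_eq_intros)
  ultimately have "((\<lambda>s. \<Phi> s (x s)) has_derivative
      (\<lambda>d. d *\<^sub>R (g (x t) t - g (x t) (t - h) + blinfun_apply (\<Phi>' t (x t)) y))) (at t within {0..})"
    using diff_chain_within by (fastforce simp: o_def blinfun.scaleR_right scaleR_right_distrib)
  then show ?thesis unfolding has_vector_derivative_def \<Phi>_def \<Phi>'_def .
qed

lemma has_real_derivative_weighted_window_integral:
  fixes n :: "real \<Rightarrow> real"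
  assumes n: "continuous_on {-h..} n" and "h \<ge> 0" "t \<ge> 0"
  shows "((\<lambda>s. integral {-h..0} (\<lambda>\<theta>. (w1 + (h + \<theta>) * w2) * n (s + \<theta>))) has_real_derivative
          (w1 + h * w2) * n t - w1 * n (t - h) - w2 * integral {-h..0} (\<lambda>\<theta>. n (t + \<theta>)))
         (at t within {0..})"
proof -
  define m where "m u = u * n u" for u
  have m: "continuous_on {-h..} m"
    unfolding m_def using n by (intro continuous_intros)
  have window_cont: "continuous_on {-h..0} (\<lambda>\<theta>. k (s + \<theta>))"
    if "continuous_on {-h..} k" "s \<ge> 0" for k :: "real \<Rightarrow> real" and s
    by (rule continuous_on_compose2[OF that(1)]) (use that(2) in \<open>auto intro!: continuous_intros\<close>)
  \<comment> \<open>The weight is affine in the absolute time s + \<theta>, so the integral splits into plain window integrals.\<close>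
  have split: "integral {-h..0} (\<lambda>\<theta>. (w1 + (h + \<theta>) * w2) * n (s + \<theta>))
      = (w1 + h * w2 - s * w2) * integral {-h..0} (\<lambda>\<theta>. n (s + \<theta>))
        + w2 * integral {-h..0} (\<lambda>\<theta>. m (s + \<theta>))" if "s \<ge> 0" for s
  proof -
    have "integral {-h..0} (\<lambda>\<theta>. (w1 + (h + \<theta>) * w2) * n (s + \<theta>))
        = integral {-h..0} (\<lambda>\<theta>. (w1 + h * w2 - s * w2) * n (s + \<theta>) + w2 * m (s + \<theta>))"
      unfolding m_def by (rule integral_cong) (simp add: algebra_simps)
    also have "\<dots> = integral {-h..0} (\<lambda>\<theta>. (w1 + h * w2 - s * w2) * n (s + \<theta>))
        + integral {-h..0} (\<lambda>\<theta>. w2 * m (s + \<theta>))"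
      using window_cont[OF n that] window_cont[OF m that]
      by (intro integral_add integrable_continuous_interval continuous_intros)
    finally show ?thesis by simp
  qed
  have n_window: "((\<lambda>s. integral {-h..0} (\<lambda>\<theta>. n (s + \<theta>))) has_real_derivative n t - n (t - h))
      (at t within {0..})"
    using has_vector_derivative_window_integral[OF n \<open>h \<ge> 0\<close> \<open>t \<ge> 0\<close>]
    unfolding has_real_derivative_iff_has_vector_derivative .
  have m_window: "((\<lambda>s. integral {-h..0} (\<lambda>\<theta>. m (s + \<theta>))) has_real_derivative m t - m (t - h))
      (at t within {0..})"
    using has_vector_derivative_window_integral[OF m \<open>h \<ge> 0\<close> \<open>t \<ge> 0\<close>]
    unfolding has_real_derivative_iff_has_vector_derivative .
  have "((\<lambda>s. (w1 + h * w2 - s * w2) * integral {-h..0} (\<lambda>\<theta>. n (s + \<theta>))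
          + w2 * integral {-h..0} (\<lambda>\<theta>. m (s + \<theta>)))
      has_real_derivative (- w2) * integral {-h..0} (\<lambda>\<theta>. n (t + \<theta>))
          + (w1 + h * w2 - t * w2) * (n t - n (t - h)) + w2 * (m t - m (t - h))) (at t within {0..})"
    by (auto intro!: derivative_eq_intros n_window m_window)
  also have "(- w2) * integral {-h..0} (\<lambda>\<theta>. n (t + \<theta>)) + (w1 + h * w2 - t * w2) * (n t - n (t - h))
      + w2 * (m t - m (t - h)) = (w1 + h * w2) * n t - w1 * n (t - h) - w2 * integral {-h..0} (\<lambda>\<theta>. n (t + \<theta>))"
    unfolding m_def by (simp add: algebra_simps)
  finally show ?thesis
    unfolding has_real_derivative_iff_has_vector_derivative
    by (rule has_vector_derivative_transform[rotated 2]) (use \<open>t \<ge> 0\<close> split in auto)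
qed

section \<open>Matrices as bounded linear maps\<close>

lemma bounded_bilinear_matrix_vector_mult:
  "bounded_bilinear (\<lambda>(M::real^'n^'m) (v::real^'n). M *v v)"
proof -
  have "bilinear (\<lambda>(M::real^'n^'m) (v::real^'n). M *v v)"
    unfolding bilinear_def
  proof safe
    fix v :: "real^'n"
    show "linear (\<lambda>M::real^'n^'m. M *v v)"
      by (rule linearI)
        (simp_all add: vec_eq_iff matrix_vector_mult_def sum_distrib_left algebra_simps sum.distrib)
  qed (rule matrix_vector_mul_linear)
  then show ?thesis by (simp add: bilinear_conv_bounded_bilinear)
qed

interpretation matrix_vector_mult: bounded_bilinear "\<lambda>(M::real^'n^'m) (v::real^'n). M *v v"
  by (rule bounded_bilinear_matrix_vector_mult)

lemma norm_matrix_vector_mult_le: "norm ((M::real^'n^'m) *v v) \<le> onorm ((*v) M) * norm v"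
  using onorm[OF matrix_vector_mul_bounded_linear] by blast

lemma norm_matrix_vector_mult_le_bound:
  assumes "onorm ((*v) M) \<le> c"
  shows "norm ((M::real^'n^'m) *v v) \<le> c * norm v"
  using norm_matrix_vector_mult_le[of M v] mult_right_mono[OF assms norm_ge_zero[of v]] by linarith

lemma integral_matrix_vector_mult:
  fixes F :: "real \<Rightarrow> real^'n^'m"
  assumes "F integrable_on S"
  shows "integral S (\<lambda>s. F s *v q) = integral S F *v q"
  using integral_linear[OF assms matrix_vector_mult.bounded_linear_left] by (simp add: o_def)

definition matrix_blinfun :: "real^'n^'m \<Rightarrow> (real^'n) \<Rightarrow>\<^sub>L (real^'m)" where
  "matrix_blinfun M = Blinfun ((*v) M)"

lemma matrix_blinfun_apply [simp]: "blinfun_apply (matrix_blinfun M) v = M *v v"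
  by (simp add: matrix_blinfun_def bounded_linear_Blinfun_apply)

lemma norm_matrix_blinfun: "norm (matrix_blinfun M) = onorm ((*v) M)"
  by (simp add: matrix_blinfun_def norm_blinfun.rep_eq bounded_linear_Blinfun_apply)

lemma continuous_on_matrix_blinfun:
  assumes "continuous_on S M"
  shows "continuous_on S (\<lambda>u. matrix_blinfun (M u))"
proof -
  have "bounded_linear (matrix_blinfun :: real^'n^'m \<Rightarrow> _)"
  proof (rule bounded_linearI')
    show "matrix_blinfun (M + N) = matrix_blinfun M + matrix_blinfun N" for M N :: "real^'n^'m"
      by (rule blinfun_eqI) (simp add: matrix_vector_mult_add_rdistrib blinfun.add_left)
    show "matrix_blinfun (c *\<^sub>R M) = c *\<^sub>R matrix_blinfun M" for c and M :: "real^'n^'m"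
      by (rule blinfun_eqI) (simp add: matrix_vector_mult.scaleR_left blinfun.scaleR_left)
  qed
  then show ?thesis
    using assms bounded_linear.continuous_on by blast
qed

section \<open>The kernel L\<close>

lemma Lmat_has_vector_derivative:
  fixes B :: "real \<Rightarrow> real^'n^'n"
  assumes B: "continuous_on {0..} B" and "h \<ge> 0" "t \<ge> 0"
  shows "(Lmat h B \<epsilon> has_vector_derivative B (t + h) - \<epsilon> *\<^sub>R Lmat h B \<epsilon> t) (at t within {0..})"
proof -
  define G where "G r = integral {0..r} (\<lambda>u. exp (\<epsilon> * u) *\<^sub>R B u)" for r
  have Lmat_eq: "Lmat h B \<epsilon> s = exp (- \<epsilon> * (s + h)) *\<^sub>R G (s + h)" for s
  proof -
    have "(\<lambda>u. exp (- \<epsilon> * (s + h - u)) *\<^sub>R B u)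
        = (\<lambda>u. exp (- \<epsilon> * (s + h)) *\<^sub>R (exp (\<epsilon> * u) *\<^sub>R B u))"
      by (rule ext) (simp add: exp_add[symmetric] algebra_simps)
    then show ?thesis unfolding Lmat_def G_def by (simp del: scaleR_scaleR)
  qed
  have "continuous_on {0..} (\<lambda>u. exp (\<epsilon> * u) *\<^sub>R B u)"
    using B by (intro continuous_intros) auto
  then have "(G has_vector_derivative exp (\<epsilon> * (t + h)) *\<^sub>R B (t + h)) (at (t + h) within {0 + h..})"
    unfolding G_def using assms
    by (intro has_vector_derivative_within_subset[OF has_vector_derivative_integral_upper]) auto
  then have "((\<lambda>s. G (s + h)) has_vector_derivative exp (\<epsilon> * (t + h)) *\<^sub>R B (t + h)) (at t within {0..})"
    by (rule has_vector_derivative_shift)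
  moreover have "((\<lambda>s. exp (- \<epsilon> * (s + h))) has_real_derivative - \<epsilon> * exp (- \<epsilon> * (t + h)))
      (at t within {0..})"
    by (auto intro!: derivative_eq_intros)
  ultimately have "(Lmat h B \<epsilon> has_vector_derivative
      exp (- \<epsilon> * (t + h)) *\<^sub>R (exp (\<epsilon> * (t + h)) *\<^sub>R B (t + h))
        + (- \<epsilon> * exp (- \<epsilon> * (t + h))) *\<^sub>R G (t + h)) (at t within {0..})"
    unfolding Lmat_eq[abs_def] by (rule has_vector_derivative_scaleR[rotated])
  moreover have "exp (- \<epsilon> * (t + h)) *\<^sub>R (exp (\<epsilon> * (t + h)) *\<^sub>R B (t + h))
      + (- \<epsilon> * exp (- \<epsilon> * (t + h))) *\<^sub>R G (t + h) = B (t + h) - \<epsilon> *\<^sub>R Lmat h B \<epsilon> t"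
  proof -
    have "exp (- \<epsilon> * (t + h)) * exp (\<epsilon> * (t + h)) = 1" by (simp add: exp_add[symmetric])
    then show ?thesis by (simp add: Lmat_eq algebra_simps)
  qed
  ultimately show ?thesis by simp
qed

lemma Lmat_mult_vector:
  assumes "continuous_on {0..} B" "t + h \<ge> 0"
  shows "Lmat h B \<epsilon> t *v q = integral {0..t + h} (\<lambda>s. exp (- \<epsilon> * (t + h - s)) *\<^sub>R (B s *v q))"
proof -
  have "(\<lambda>s. exp (- \<epsilon> * (t + h - s)) *\<^sub>R B s) integrable_on {0..t + h}"
    using assms by (intro integrable_continuous_interval continuous_intros continuous_on_subset[OF assms(1)]) auto
  from integral_matrix_vector_mult[OF this, of q] show ?thesis
    unfolding Lmat_def by (simp add: matrix_vector_mult.scaleR_left)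
qed

lemma exp_kernel_has_integral:
  fixes \<epsilon> \<tau> :: real
  assumes "\<epsilon> > 0" "\<tau> \<ge> 0"
  shows "((\<lambda>s. exp (- \<epsilon> * (\<tau> - s))) has_integral (1 - exp (- \<epsilon> * \<tau>)) / \<epsilon>) {0..\<tau>}"
proof -
  have "((\<lambda>s. exp (- \<epsilon> * (\<tau> - s)) / \<epsilon>) has_vector_derivative exp (- \<epsilon> * (\<tau> - s)))
      (at s within {0..\<tau>})" for s
    using assms unfolding has_real_derivative_iff_has_vector_derivative[symmetric]
    by (auto intro!: derivative_eq_intros)
  from fundamental_theorem_of_calculus[OF \<open>\<tau> \<ge> 0\<close> this]
  show ?thesis by (simp add: diff_divide_distrib)
qed

lemma norm_exp_kernel_integral_le:
  fixes v :: "real \<Rightarrow> 'a::euclidean_space"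
  assumes "\<epsilon> > 0" "\<tau> \<ge> 0"
    and v_cont: "continuous_on {0..\<tau>} v" and v_le: "\<And>s. s \<in> {0..\<tau>} \<Longrightarrow> norm (v s) \<le> c"
  shows "\<epsilon> * norm (integral {0..\<tau>} (\<lambda>s. exp (- \<epsilon> * (\<tau> - s)) *\<^sub>R v s)) \<le> c"
proof -
  have "c \<ge> 0" using v_le[of 0] \<open>\<tau> \<ge> 0\<close> by (meson atLeastAtMost_iff norm_ge_zero order_trans order_refl)
  have "norm (integral {0..\<tau>} (\<lambda>s. exp (- \<epsilon> * (\<tau> - s)) *\<^sub>R v s))
      \<le> integral {0..\<tau>} (\<lambda>s. c * exp (- \<epsilon> * (\<tau> - s)))"
  proof (rule Henstock_Kurzweil_Integration.integral_norm_bound_integral)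
    show "(\<lambda>s. exp (- \<epsilon> * (\<tau> - s)) *\<^sub>R v s) integrable_on {0..\<tau>}"
      using v_cont by (intro integrable_continuous_interval continuous_intros)
    show "(\<lambda>s. c * exp (- \<epsilon> * (\<tau> - s))) integrable_on {0..\<tau>}"
      using exp_kernel_has_integral[OF assms(1,2)] by (intro integrable_on_mult_right) blast
  qed (use v_le in \<open>simp add: mult.commute\<close>)
  also have "\<dots> = c * ((1 - exp (- \<epsilon> * \<tau>)) / \<epsilon>)"
    using integral_unique[OF exp_kernel_has_integral[OF assms(1,2)]] by simp
  finally have "\<epsilon> * norm (integral {0..\<tau>} (\<lambda>s. exp (- \<epsilon> * (\<tau> - s)) *\<^sub>R v s))
      \<le> c * (1 - exp (- \<epsilon> * \<tau>))"
    using \<open>\<epsilon> > 0\<close> by (simp add: field_simps)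
  also have "\<dots> \<le> c" using \<open>c \<ge> 0\<close> by (simp add: mult_left_le)
  finally show ?thesis .
qed

lemma exp_kernel_integral_by_parts:
  fixes C c :: "real \<Rightarrow> 'a::banach"
  assumes C_deriv: "\<And>s. s \<ge> 0 \<Longrightarrow> (C has_vector_derivative c s) (at s within {0..})"
    and "\<tau> \<ge> 0"
  shows "((\<lambda>s. exp (- \<epsilon> * (\<tau> - s)) *\<^sub>R c s) has_integral
          C \<tau> - exp (- \<epsilon> * \<tau>) *\<^sub>R C 0 - \<epsilon> *\<^sub>R integral {0..\<tau>} (\<lambda>s. exp (- \<epsilon> * (\<tau> - s)) *\<^sub>R C s))
         {0..\<tau>}"
proof -
  define \<phi> where "\<phi> s = exp (- \<epsilon> * (\<tau> - s))" for s
  have "((\<lambda>s. \<phi> s *\<^sub>R C s) has_vector_derivative \<phi> s *\<^sub>R c s + (\<epsilon> * \<phi> s) *\<^sub>R C s)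
      (at s within {0..\<tau>})" if "s \<in> {0..\<tau>}" for s
  proof -
    have "(\<phi> has_real_derivative \<epsilon> * \<phi> s) (at s within {0..})"
      unfolding \<phi>_def by (auto intro!: derivative_eq_intros simp: algebra_simps)
    from has_vector_derivative_scaleR[OF this C_deriv] that
    have "((\<lambda>s. \<phi> s *\<^sub>R C s) has_vector_derivative \<phi> s *\<^sub>R c s + (\<epsilon> * \<phi> s) *\<^sub>R C s)
        (at s within {0..})"
      by (simp add: add.commute)
    then show ?thesis
      by (rule has_vector_derivative_within_subset) auto
  qed
  then have parts: "((\<lambda>s. \<phi> s *\<^sub>R c s + (\<epsilon> * \<phi> s) *\<^sub>R C s) has_integral \<phi> \<tau> *\<^sub>R C \<tau> - \<phi> 0 *\<^sub>R C 0)
      {0..\<tau>}"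
    by (rule fundamental_theorem_of_calculus[OF \<open>\<tau> \<ge> 0\<close>])
  have "continuous_on {0..} C"
    using C_deriv by (intro continuous_on_if_has_vector_derivative) auto
  then have "continuous_on {0..\<tau>} C"
    by (rule continuous_on_subset) auto
  then have "((\<lambda>s. \<epsilon> *\<^sub>R (\<phi> s *\<^sub>R C s)) has_integral \<epsilon> *\<^sub>R integral {0..\<tau>} (\<lambda>s. \<phi> s *\<^sub>R C s)) {0..\<tau>}"
    unfolding \<phi>_def
    by (intro has_integral_cmul integrable_integral integrable_continuous_interval continuous_intros)
  from has_integral_diff[OF parts this]
  show ?thesis unfolding \<phi>_def by (simp add: algebra_simps)
qed

lemma integral_primitive_diff:
  fixes b :: "real \<Rightarrow> 'a::banach"
  assumes "continuous_on {0..} b" "0 \<le> s" "s \<le> u"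
  shows "integral {0..u} b - integral {0..s} b = integral {s..u} b"
proof -
  have "b integrable_on {0..u}"
    using assms by (intro integrable_continuous_interval continuous_on_subset[OF assms(1)]) auto
  then show ?thesis
    using Henstock_Kurzweil_Integration.integral_combine[of 0 s u b] assms by (simp add: algebra_simps)
qed

lemma norm_integral_primitive_increment_le:
  fixes b :: "real \<Rightarrow> 'a::banach"
  assumes b_cont: "continuous_on {0..} b" and b_le: "\<And>s. s \<ge> 0 \<Longrightarrow> norm (b s) \<le> M"
    and "T \<ge> 0" "s \<ge> 0"
  shows "norm (integral {s..s + T} (\<lambda>u. integral {0..u} b - integral {0..s} b)) \<le> M * T * T"
proof -
  have "continuous_on {0..} (\<lambda>u. integral {0..u} b)"
    using has_vector_derivative_integral_upper[OF b_cont]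
    by (intro continuous_on_if_has_vector_derivative) auto
  then have "continuous_on {s..s + T} (\<lambda>u. integral {0..u} b)"
    by (rule continuous_on_subset) (use \<open>s \<ge> 0\<close> in auto)
  then have "continuous_on {s..s + T} (\<lambda>u. integral {0..u} b - integral {0..s} b)"
    by (intro continuous_intros)
  then have "norm (integral {s..s + T} (\<lambda>u. integral {0..u} b - integral {0..s} b)) \<le> (M * T) * ((s + T) - s)"
  proof (rule integral_bound[rotated])
    fix u assume u: "u \<in> {s..s + T}"
    have "norm (integral {0..u} b - integral {0..s} b) = norm (integral {s..u} b)"
      using integral_primitive_diff[OF b_cont, of s u] u \<open>s \<ge> 0\<close> by simp
    also have "\<dots> \<le> M * (u - s)"
      using u \<open>s \<ge> 0\<close> by (intro integral_bound continuous_on_subset[OF b_cont] b_le) auto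
    also have "\<dots> \<le> M * T"
      using u b_le[of s] \<open>s \<ge> 0\<close> by (intro mult_left_mono) (auto intro: order_trans[OF norm_ge_zero])
    finally show "norm (integral {0..u} b - integral {0..s} b) \<le> M * T" .
  qed (use \<open>T \<ge> 0\<close> in simp)
  then show ?thesis by simp
qed

text \<open>Here v is the moving T-average of b, and C s is the mean of the primitive of b over
  [s, s + T] minus its value at s.\<close>

lemma moving_average_decomposition:
  fixes b :: "real \<Rightarrow> 'a::euclidean_space"
  assumes b_cont: "continuous_on {0..} b" and b_le: "\<And>s. s \<ge> 0 \<Longrightarrow> norm (b s) \<le> M"
    and "T > 0" and average_le: "\<And>s. s \<ge> 0 \<Longrightarrow> norm (integral {s..s + T} b) \<le> e * T"
  obtains v C where "continuous_on {0..} v" "\<And>s. s \<ge> 0 \<Longrightarrow> norm (v s) \<le> e"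
    "\<And>s. s \<ge> 0 \<Longrightarrow> (C has_vector_derivative v s - b s) (at s within {0..})"
    "\<And>s. s \<ge> 0 \<Longrightarrow> norm (C s) \<le> M * T"
proof
  define A where "A s = integral {0..s} b" for s
  define v where "v s = (1 / T) *\<^sub>R (A (s + T) - A s)" for s
  define C where "C s = (1 / T) *\<^sub>R (integral {0..s + T} A - integral {0..s} A) - A s" for s
  have A_deriv: "(A has_vector_derivative b s) (at s within {0..})" if "s \<ge> 0" for s
    unfolding A_def using has_vector_derivative_integral_upper[OF b_cont that] .
  then have A_cont: "continuous_on {0..} A"
    by (intro continuous_on_if_has_vector_derivative) auto
  have "continuous_on {0..} (\<lambda>s. A (s + T))"
    by (rule continuous_on_compose2[OF A_cont]) (use \<open>T > 0\<close> in \<open>auto intro!: continuous_intros\<close>)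
  then show "continuous_on {0..} v"
    unfolding v_def using A_cont by (intro continuous_intros)
  show "norm (v s) \<le> e" if "s \<ge> 0" for s
    using average_le[OF that] \<open>T > 0\<close> integral_primitive_diff[OF b_cont that, of "s + T"]
    unfolding v_def A_def by (simp add: field_simps)
  show "(C has_vector_derivative v s - b s) (at s within {0..})" if "s \<ge> 0" for s
  proof -
    have "((\<lambda>r. integral {0..r} A) has_vector_derivative A (s + T)) (at (s + T) within {0 + T..})"
      using has_vector_derivative_integral_upper[OF A_cont, of "s + T"] that \<open>T > 0\<close>
      by (intro has_vector_derivative_within_subset[where S="{0..}" and T="{0 + T..}"]) auto
    then have "((\<lambda>r. integral {0..r + T} A) has_vector_derivative A (s + T)) (at s within {0..})"
      by (rule has_vector_derivative_shift)
    with has_vector_derivative_integral_upper[OF A_cont that] A_deriv[OF that]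
    show ?thesis
      unfolding C_def v_def by (auto intro!: derivative_eq_intros)
  qed
  show "norm (C s) \<le> M * T" if "s \<ge> 0" for s
  proof -
    have "A integrable_on {s..s + T}"
      using that by (intro integrable_continuous_interval continuous_on_subset[OF A_cont]) auto
    then have "integral {s..s + T} A = T *\<^sub>R A s + integral {s..s + T} (\<lambda>u. A u - A s)"
      using \<open>T > 0\<close> by (subst integral_diff) auto
    then have "C s = (1 / T) *\<^sub>R integral {s..s + T} (\<lambda>u. A u - A s)"
      using integral_primitive_diff[OF A_cont that, of "s + T"] \<open>T > 0\<close>
      unfolding C_def by (simp add: scaleR_add_right)
    then show ?thesis
      using norm_integral_primitive_increment_le[OF b_cont b_le, of T s] that \<open>T > 0\<close>
      unfolding A_def by (simp add: field_simps)
  qed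
qed

text \<open>Split b = v - C' as above; integrating C' by parts against the kernel costs only
  O(\<epsilon> M T).\<close>

lemma exp_kernel_integral_le_average:
  fixes b :: "real \<Rightarrow> 'a::euclidean_space"
  assumes b_cont: "continuous_on {0..} b" and b_le: "\<And>s. s \<ge> 0 \<Longrightarrow> norm (b s) \<le> M"
    and "T > 0" and average_le: "\<And>s. s \<ge> 0 \<Longrightarrow> norm (integral {s..s + T} b) \<le> e * T"
    and "\<epsilon> > 0" "\<tau> \<ge> 0"
  shows "\<epsilon> * norm (integral {0..\<tau>} (\<lambda>s. exp (- \<epsilon> * (\<tau> - s)) *\<^sub>R b s)) \<le> e + 3 * \<epsilon> * M * T"
proof -
  obtain v C where v_cont: "continuous_on {0..} v" and v_le: "\<And>s. s \<ge> 0 \<Longrightarrow> norm (v s) \<le> e"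
    and C_deriv: "\<And>s. s \<ge> 0 \<Longrightarrow> (C has_vector_derivative v s - b s) (at s within {0..})"
    and C_le: "\<And>s. s \<ge> 0 \<Longrightarrow> norm (C s) \<le> M * T"
    using moving_average_decomposition[OF b_cont b_le \<open>T > 0\<close> average_le] by blast
  define \<phi> where "\<phi> s = exp (- \<epsilon> * (\<tau> - s))" for s
  define X where "X = integral {0..\<tau>} (\<lambda>s. \<phi> s *\<^sub>R v s)"
  define Y where "Y = integral {0..\<tau>} (\<lambda>s. \<phi> s *\<^sub>R C s)"
  define Z where "Z = C \<tau> - \<phi> 0 *\<^sub>R C 0"
  have "((\<lambda>s. \<phi> s *\<^sub>R v s) has_integral X) {0..\<tau>}"
    unfolding X_def \<phi>_def
    by (intro integrable_integral integrable_continuous_interval continuous_intros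
        continuous_on_subset[OF v_cont]) auto
  from has_integral_diff[OF this exp_kernel_integral_by_parts[OF C_deriv \<open>\<tau> \<ge> 0\<close>, of \<epsilon>]]
  have integral_eq: "integral {0..\<tau>} (\<lambda>s. \<phi> s *\<^sub>R b s) = X - (Z - \<epsilon> *\<^sub>R Y)"
    unfolding \<phi>_def Y_def Z_def by (intro integral_unique) (simp add: algebra_simps)
  have "\<epsilon> * norm X \<le> e"
    unfolding X_def \<phi>_def using \<open>\<epsilon> > 0\<close> \<open>\<tau> \<ge> 0\<close> v_le
    by (intro norm_exp_kernel_integral_le continuous_on_subset[OF v_cont]) auto
  moreover have "\<epsilon> * norm Y \<le> M * T"
    unfolding Y_def \<phi>_def using \<open>\<epsilon> > 0\<close> \<open>\<tau> \<ge> 0\<close> C_le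
    by (intro norm_exp_kernel_integral_le continuous_on_subset[OF continuous_on_if_has_vector_derivative[OF C_deriv]]) auto
  moreover have "norm Z \<le> 2 * (M * T)"
  proof -
    have "norm Z \<le> norm (C \<tau>) + \<phi> 0 * norm (C 0)"
      using norm_triangle_ineq4[of "C \<tau>" "\<phi> 0 *\<^sub>R C 0"] unfolding Z_def \<phi>_def by simp
    also have "\<dots> \<le> M * T + 1 * (M * T)"
      using C_le[OF \<open>\<tau> \<ge> 0\<close>] C_le[of 0] \<open>\<epsilon> > 0\<close> \<open>\<tau> \<ge> 0\<close> unfolding \<phi>_def
      by (intro add_mono mult_mono) auto
    finally show ?thesis by simp
  qed
  moreover have "norm (X - (Z - \<epsilon> *\<^sub>R Y)) \<le> norm X + norm Z + \<epsilon> * norm Y"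
    using norm_triangle_ineq4[of X "Z - \<epsilon> *\<^sub>R Y"] norm_triangle_ineq4[of Z "\<epsilon> *\<^sub>R Y"] \<open>\<epsilon> > 0\<close>
    by simp
  ultimately have "\<epsilon> * norm (X - (Z - \<epsilon> *\<^sub>R Y)) \<le> \<epsilon> * norm X + \<epsilon> * norm Z + \<epsilon> * (\<epsilon> * norm Y)"
    and "\<epsilon> * norm Z \<le> \<epsilon> * (2 * (M * T))" and "\<epsilon> * (\<epsilon> * norm Y) \<le> \<epsilon> * (M * T)"
    using \<open>\<epsilon> > 0\<close> by (auto simp: algebra_simps dest: mult_left_mono[of _ _ \<epsilon>])
  with \<open>\<epsilon> * norm X \<le> e\<close> have "\<epsilon> * norm (X - (Z - \<epsilon> *\<^sub>R Y)) \<le> e + 3 * \<epsilon> * M * T"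
    by (simp add: algebra_simps)
  then show ?thesis
    using integral_eq unfolding \<phi>_def by simp
qed

lemma norm_Lmat_mult_le_primitive_bound:
  assumes "\<And>t. t \<ge> 0 \<Longrightarrow> onorm ((*v) (integral {0..t} B)) \<le> K" "t + h \<ge> 0"
  shows "norm (Lmat h B 0 t *v q) \<le> K * norm q"
proof -
  have "norm (Lmat h B 0 t *v q) \<le> onorm ((*v) (integral {0..t + h} B)) * norm q"
    using norm_matrix_vector_mult_le unfolding Lmat_def by simp
  also have "\<dots> \<le> K * norm q"
    using assms by (intro mult_right_mono) auto
  finally show ?thesis .
qed

lemma norm_Lmat_mult_le:
  assumes B_cont: "continuous_on {0..} B" and B_le: "\<And>t. t \<ge> 0 \<Longrightarrow> onorm ((*v) (B t)) \<le> bh"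
    and "\<epsilon> > 0" "t + h \<ge> 0"
  shows "norm (Lmat h B \<epsilon> t *v q) \<le> bh / \<epsilon> * norm q"
proof -
  have "\<epsilon> * norm (integral {0..t + h} (\<lambda>s. exp (- \<epsilon> * (t + h - s)) *\<^sub>R (B s *v q))) \<le> bh * norm q"
  proof (rule norm_exp_kernel_integral_le)
    show "continuous_on {0..t + h} (\<lambda>s. B s *v q)"
      using B_cont by (intro matrix_vector_mult.continuous_on continuous_intros continuous_on_subset[OF B_cont]) auto
    show "norm (B s *v q) \<le> bh * norm q" if "s \<in> {0..t + h}" for s
      using that by (intro norm_matrix_vector_mult_le_bound B_le) auto
  qed (use assms in auto)
  then show ?thesis
    using Lmat_mult_vector[OF B_cont \<open>t + h \<ge> 0\<close>] \<open>\<epsilon> > 0\<close> by (simp add: field_simps mult.commute)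
qed

lemma norm_eps_Lmat_mult_le_average:
  assumes B_cont: "continuous_on {0..} B" and B_le: "\<And>t. t \<ge> 0 \<Longrightarrow> onorm ((*v) (B t)) \<le> bh"
    and "T > 0" and average_le: "\<And>s. s \<ge> 0 \<Longrightarrow> onorm ((*v) ((1 / T) *\<^sub>R integral {s..s + T} B)) \<le> \<omega>"
    and "\<epsilon> > 0" "t + h \<ge> 0"
  shows "norm ((\<epsilon> *\<^sub>R Lmat h B \<epsilon> t) *v q) \<le> (\<omega> + 3 * \<epsilon> * bh * T) * norm q"
proof -
  have "\<epsilon> * norm (integral {0..t + h} (\<lambda>s. exp (- \<epsilon> * (t + h - s)) *\<^sub>R (B s *v q)))
      \<le> \<omega> * norm q + 3 * \<epsilon> * (bh * norm q) * T"
  proof (rule exp_kernel_integral_le_average)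
    show "continuous_on {0..} (\<lambda>s. B s *v q)"
      using B_cont by (intro matrix_vector_mult.continuous_on continuous_intros)
    show "norm (B s *v q) \<le> bh * norm q" if "s \<ge> 0" for s
      using that by (intro norm_matrix_vector_mult_le_bound B_le)
    show "norm (integral {s..s + T} (\<lambda>u. B u *v q)) \<le> \<omega> * norm q * T" if "s \<ge> 0" for s
    proof -
      have "B integrable_on {s..s + T}"
        using that by (intro integrable_continuous_interval continuous_on_subset[OF B_cont]) auto
      then have "integral {s..s + T} (\<lambda>u. B u *v q) = T *\<^sub>R (((1 / T) *\<^sub>R integral {s..s + T} B) *v q)"
        using \<open>T > 0\<close> by (simp add: integral_matrix_vector_mult matrix_vector_mult.scaleR_left)
      also have "norm \<dots> \<le> T * (\<omega> * norm q)"
        using norm_matrix_vector_mult_le_bound[OF average_le[OF that]] \<open>T > 0\<close> by simp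
      finally show ?thesis by (simp add: mult.commute)
    qed
  qed (use assms in auto)
  then show ?thesis
    using Lmat_mult_vector[OF B_cont \<open>t + h \<ge> 0\<close>] \<open>\<epsilon> > 0\<close>
    by (simp add: matrix_vector_mult.scaleR_left algebra_simps)
qed

section \<open>The derivative of the functional along solutions\<close>

lemma continuous_on_partial_derivatives:
  assumes "\<And>a b. ((\<lambda>p. F (fst p) (snd p)) has_derivative
             (\<lambda>u. blinfun_apply (F1 a b) (fst u) + blinfun_apply (F2 a b) (snd u))) (at (a, b))"
  shows "continuous_on UNIV (\<lambda>p. F (fst p) (snd p))"
proof (rule has_derivative_continuous_on)
  fix p :: "'a \<times> 'b"
  show "((\<lambda>p. F (fst p) (snd p)) has_derivative (\<lambda>u. blinfun_apply (F1 (fst p) (snd p)) (fst u)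
      + blinfun_apply (F2 (fst p) (snd p)) (snd u))) (at p within UNIV)"
    using assms[of "fst p" "snd p"] by simp
qed

lemma has_derivative_first_argument:
  assumes "((\<lambda>p. F (fst p) (snd p)) has_derivative
             (\<lambda>u. blinfun_apply (F1 a b) (fst u) + blinfun_apply (F2 a b) (snd u))) (at (a, b))"
  shows "((\<lambda>a. F a b) has_derivative blinfun_apply (F1 a b)) (at a)"
proof -
  have "((\<lambda>a. (a, b)) has_derivative (\<lambda>d. (d, 0))) (at a)"
    by (auto intro!: derivative_eq_intros)
  from has_derivative_compose[OF this assms] show ?thesis by (simp add: o_def)
qed

lemma continuous_on_compose_delayed:
  fixes F :: "'a::topological_space \<Rightarrow> 'b::topological_space \<Rightarrow> 'c::topological_space"
  assumes "continuous_on UNIV (\<lambda>p. F (fst p) (snd p))" "continuous_on {-h..} x"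
  shows "continuous_on (UNIV \<times> {-h..}) (\<lambda>p. F (fst p) (x (snd p)))"
proof -
  have "continuous_on (UNIV \<times> {-h..}) (\<lambda>p. x (snd p))"
    by (rule continuous_on_compose2[OF assms(2)]) (auto intro!: continuous_intros)
  then have "continuous_on (UNIV \<times> {-h..}) (\<lambda>p. (fst p, x (snd p)))"
    by (intro continuous_intros)
  from continuous_on_compose2[OF assms(1) this] show ?thesis by simp
qed

lemma has_vector_derivative_window_integral_field:
  fixes f Q :: "real^'n \<Rightarrow> real^'n \<Rightarrow> real^'n"
    and f1 f2 Q1 Q2 :: "real^'n \<Rightarrow> real^'n \<Rightarrow> (real^'n) \<Rightarrow>\<^sub>L (real^'n)"
    and B :: "real \<Rightarrow> real^'n^'n"
  assumes f_deriv: "\<And>a b. ((\<lambda>p. f (fst p) (snd p)) has_derivative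
                     (\<lambda>u. blinfun_apply (f1 a b) (fst u) + blinfun_apply (f2 a b) (snd u))) (at (a, b))"
    and f1_cont: "continuous_on UNIV (\<lambda>p. f1 (fst p) (snd p))"
    and Q_deriv: "\<And>a b. ((\<lambda>p. Q (fst p) (snd p)) has_derivative
                     (\<lambda>u. blinfun_apply (Q1 a b) (fst u) + blinfun_apply (Q2 a b) (snd u))) (at (a, b))"
    and Q1_cont: "continuous_on UNIV (\<lambda>p. Q1 (fst p) (snd p))"
    and B_cont: "continuous_on {0..} B"
    and x_cont: "continuous_on {-h..} x" and x_deriv: "(x has_vector_derivative y) (at t within {0..})"
    and "h \<ge> 0" "t \<ge> 0"
  shows "((\<lambda>s. integral {-h..0} (\<lambda>\<theta>. f (x s) (x (s + \<theta>)) + B (s + \<theta> + h) *v Q (x s) (x (s + \<theta>))))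
          has_vector_derivative
            (f (x t) (x t) + B (t + h) *v Q (x t) (x t))
            - (f (x t) (x (t - h)) + B t *v Q (x t) (x (t - h)))
            + blinfun_apply (integral {-h..0} (\<lambda>\<theta>. f1 (x t) (x (t + \<theta>))
                + (matrix_blinfun (B (t + \<theta> + h)) o\<^sub>L Q1 (x t) (x (t + \<theta>))))) y)
         (at t within {0..})"
proof -
  define g where "g a u = f a (x u) + B (u + h) *v Q a (x u)" for a u
  define g' where "g' a u = f1 a (x u) + (matrix_blinfun (B (u + h)) o\<^sub>L Q1 a (x u))" for a u
  have B_cont': "continuous_on (UNIV \<times> {-h..}) (\<lambda>p::(real^'n) \<times> real. B (snd p + h))"
    by (rule continuous_on_compose2[OF B_cont]) (auto intro!: continuous_intros)
  have "continuous_on (UNIV \<times> {-h..}) (\<lambda>p. g (fst p) (snd p))"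
    unfolding g_def
    using continuous_on_compose_delayed[OF continuous_on_partial_derivatives[OF f_deriv] x_cont]
      continuous_on_compose_delayed[OF continuous_on_partial_derivatives[OF Q_deriv] x_cont] B_cont'
    by (intro continuous_intros matrix_vector_mult.continuous_on) auto
  moreover have "continuous_on (UNIV \<times> {-h..}) (\<lambda>p. g' (fst p) (snd p))"
    unfolding g'_def
    using continuous_on_compose_delayed[OF f1_cont x_cont] continuous_on_compose_delayed[OF Q1_cont x_cont]
      continuous_on_matrix_blinfun[OF B_cont']
    by (intro continuous_intros) auto
  moreover have "((\<lambda>a. g a u) has_derivative blinfun_apply (g' a u)) (at a)" for a u
  proof -
    have "blinfun_apply (g' a u) = (\<lambda>d. blinfun_apply (f1 a (x u)) d + B (u + h) *v blinfun_apply (Q1 a (x u)) d)"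
      unfolding g'_def by (rule ext) (simp add: blinfun.add_left)
    moreover have "((\<lambda>a. f a (x u)) has_derivative blinfun_apply (f1 a (x u))) (at a)"
      by (rule has_derivative_first_argument[OF f_deriv])
    moreover have "((\<lambda>a. Q a (x u)) has_derivative blinfun_apply (Q1 a (x u))) (at a)"
      by (rule has_derivative_first_argument[OF Q_deriv])
    ultimately show ?thesis
      unfolding g_def
      by (auto intro!: derivative_eq_intros bounded_linear.has_derivative[OF matrix_vector_mul_bounded_linear])
  qed
  ultimately show ?thesis
    using has_vector_derivative_window_integral_param[OF _ _ _ \<open>h \<ge> 0\<close> \<open>t \<ge> 0\<close> x_deriv, of g g']
    unfolding g_def g'_def by simp
qed

lemma Lmat_mult_diagonal_has_vector_derivative:
  fixes Q :: "real^'n \<Rightarrow> real^'n \<Rightarrow> real^'n"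
    and Q1 Q2 :: "real^'n \<Rightarrow> real^'n \<Rightarrow> (real^'n) \<Rightarrow>\<^sub>L (real^'n)"
  assumes Q_deriv: "\<And>a b. ((\<lambda>p. Q (fst p) (snd p)) has_derivative
                     (\<lambda>u. blinfun_apply (Q1 a b) (fst u) + blinfun_apply (Q2 a b) (snd u))) (at (a, b))"
    and B_cont: "continuous_on {0..} B"
    and x_deriv: "(x has_vector_derivative y) (at t within {0..})" and "h \<ge> 0" "t \<ge> 0"
  shows "((\<lambda>s. Lmat h B \<epsilon> s *v Q (x s) (x s)) has_vector_derivative
      (B (t + h) - \<epsilon> *\<^sub>R Lmat h B \<epsilon> t) *v Q (x t) (x t)
        + Lmat h B \<epsilon> t *v (blinfun_apply (Q1 (x t) (x t)) y + blinfun_apply (Q2 (x t) (x t)) y))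
      (at t within {0..})"
proof -
  have "((\<lambda>s. (x s, x s)) has_derivative (\<lambda>d. (d *\<^sub>R y, d *\<^sub>R y))) (at t within {0..})"
    using x_deriv by (auto intro!: derivative_eq_intros simp: has_vector_derivative_def)
  from has_derivative_compose[OF this Q_deriv[of "x t" "x t"]]
  have "((\<lambda>s. Q (x s) (x s)) has_derivative
      (\<lambda>d. d *\<^sub>R (blinfun_apply (Q1 (x t) (x t)) y + blinfun_apply (Q2 (x t) (x t)) y))) (at t within {0..})"
    by (simp add: blinfun.scaleR_right scaleR_right_distrib)
  from matrix_vector_mult.FDERIV[OF Lmat_has_vector_derivative[OF B_cont \<open>h \<ge> 0\<close> \<open>t \<ge> 0\<close>, of \<epsilon>,
        unfolded has_vector_derivative_def] this]
  show ?thesis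
    unfolding has_vector_derivative_def
    by (simp add: matrix_vector_mult_scaleR matrix_vector_mult.scaleR_left scaleR_right_distrib algebra_simps)
qed

lemma vfun_has_real_derivative:
  fixes f Q :: "real^'n \<Rightarrow> real^'n \<Rightarrow> real^'n"
    and f1 f2 Q1 Q2 :: "real^'n \<Rightarrow> real^'n \<Rightarrow> (real^'n) \<Rightarrow>\<^sub>L (real^'n)"
    and B :: "real \<Rightarrow> real^'n^'n"
    and V :: "real^'n \<Rightarrow> real" and V' :: "real^'n \<Rightarrow> real^'n"
    and V'' :: "real^'n \<Rightarrow> (real^'n) \<Rightarrow>\<^sub>L (real^'n)"
  assumes f_deriv: "\<And>a b. ((\<lambda>p. f (fst p) (snd p)) has_derivative
                     (\<lambda>u. blinfun_apply (f1 a b) (fst u) + blinfun_apply (f2 a b) (snd u))) (at (a, b))"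
    and f1_cont: "continuous_on UNIV (\<lambda>p. f1 (fst p) (snd p))"
    and Q_deriv: "\<And>a b. ((\<lambda>p. Q (fst p) (snd p)) has_derivative
                     (\<lambda>u. blinfun_apply (Q1 a b) (fst u) + blinfun_apply (Q2 a b) (snd u))) (at (a, b))"
    and Q1_cont: "continuous_on UNIV (\<lambda>p. Q1 (fst p) (snd p))"
    and B_cont: "continuous_on {0..} B"
    and V_deriv: "\<And>a. (V has_derivative (\<lambda>u. V' a \<bullet> u)) (at a)"
    and V'_deriv: "\<And>a. (V' has_derivative blinfun_apply (V'' a)) (at a)"
    and sol: "is_solution h f B Q x"
    and "h \<ge> 0" "t \<ge> 0" "\<gamma> + \<mu> - 1 > 0"
  defines "a \<equiv> x t" and "b \<equiv> x (t - h)"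
    and "y \<equiv> f (x t) (x (t - h)) + B t *v Q (x t) (x (t - h))"
  shows "((\<lambda>s. vfun h f B Q V V' \<gamma> \<mu> w1 w2 \<epsilon> s (state x s)) has_real_derivative
     (V' a \<bullet> y
      + blinfun_apply (V'' a) y \<bullet> (integral {-h..0} (\<lambda>\<theta>. f a (x (t + \<theta>)) + B (t + \<theta> + h) *v Q a (x (t + \<theta>)))
                                 - Lmat h B \<epsilon> t *v Q a a)
      + V' a \<bullet> ((f a a + B (t + h) *v Q a a) - (f a b + B t *v Q a b)
            + blinfun_apply (integral {-h..0} (\<lambda>\<theta>. f1 a (x (t + \<theta>))
                + (matrix_blinfun (B (t + \<theta> + h)) o\<^sub>L Q1 a (x (t + \<theta>))))) y
            - ((B (t + h) - \<epsilon> *\<^sub>R Lmat h B \<epsilon> t) *v Q a a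
                + Lmat h B \<epsilon> t *v (blinfun_apply (Q1 a a) y + blinfun_apply (Q2 a a) y)))
      + ((w1 + h * w2) * norm a powr (\<gamma> + \<mu> - 1) - w1 * norm b powr (\<gamma> + \<mu> - 1)
         - w2 * integral {-h..0} (\<lambda>\<theta>. norm (x (t + \<theta>)) powr (\<gamma> + \<mu> - 1)))))
     (at t within {0..})"
proof -
  have x_cont: "continuous_on {-h..} x" and x_deriv: "(x has_vector_derivative y) (at t within {0..})"
    using sol \<open>t \<ge> 0\<close> unfolding is_solution_def y_def by auto
  then have x_deriv': "(x has_derivative (\<lambda>d. d *\<^sub>R y)) (at t within {0..})"
    by (simp add: has_vector_derivative_def)
  define P where "P s = integral {-h..0} (\<lambda>\<theta>. f (x s) (x (s + \<theta>)) + B (s + \<theta> + h) *v Q (x s) (x (s + \<theta>)))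
      - Lmat h B \<epsilon> s *v Q (x s) (x s)" for s
  define P' where "P' = (f a a + B (t + h) *v Q a a) - (f a b + B t *v Q a b)
      + blinfun_apply (integral {-h..0} (\<lambda>\<theta>. f1 a (x (t + \<theta>))
          + (matrix_blinfun (B (t + \<theta> + h)) o\<^sub>L Q1 a (x (t + \<theta>))))) y
      - ((B (t + h) - \<epsilon> *\<^sub>R Lmat h B \<epsilon> t) *v Q a a
          + Lmat h B \<epsilon> t *v (blinfun_apply (Q1 a a) y + blinfun_apply (Q2 a a) y))"
  define n where "n u = norm (x u) powr (\<gamma> + \<mu> - 1)" for u
  have "(P has_vector_derivative P') (at t within {0..})"
    unfolding P_def P'_def a_def b_def
    by (rule has_vector_derivative_diff[OF
          has_vector_derivative_window_integral_field[OF f_deriv f1_cont Q_deriv Q1_cont B_cont x_cont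
            x_deriv \<open>h \<ge> 0\<close> \<open>t \<ge> 0\<close>]
          Lmat_mult_diagonal_has_vector_derivative[OF Q_deriv B_cont x_deriv \<open>h \<ge> 0\<close> \<open>t \<ge> 0\<close>]])
  then have P_deriv: "(P has_derivative (\<lambda>d. d *\<^sub>R P')) (at t within {0..})"
    by (simp add: has_vector_derivative_def)
  have "((\<lambda>s. V' (x s) \<bullet> P s) has_real_derivative blinfun_apply (V'' a) y \<bullet> P t + V' a \<bullet> P')
      (at t within {0..})"
  proof -
    have "((\<lambda>s. V' (x s)) has_derivative (\<lambda>d. d *\<^sub>R blinfun_apply (V'' a) y)) (at t within {0..})"
      using has_derivative_compose[OF x_deriv' V'_deriv[of "x t"]]
      unfolding a_def by (simp add: blinfun.scaleR_right)
    from has_derivative_inner[OF this P_deriv]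
    have "((\<lambda>s. V' (x s) \<bullet> P s) has_derivative
        (\<lambda>d. V' (x t) \<bullet> (d *\<^sub>R P') + (d *\<^sub>R blinfun_apply (V'' a) y) \<bullet> P t)) (at t within {0..})" .
    moreover have "(\<lambda>d. V' (x t) \<bullet> (d *\<^sub>R P') + (d *\<^sub>R blinfun_apply (V'' a) y) \<bullet> P t)
        = (*) (blinfun_apply (V'' a) y \<bullet> P t + V' a \<bullet> P')"
      unfolding a_def by (rule ext) (simp add: algebra_simps)
    ultimately show ?thesis
      unfolding has_field_derivative_def by simp
  qed
  moreover have "((\<lambda>s. V (x s)) has_real_derivative V' a \<bullet> y) (at t within {0..})"
    using has_derivative_compose[OF x_deriv' V_deriv[of "x t"]]
    unfolding has_field_derivative_def a_def by (simp add: mult.commute[of _ "V' (x t) \<bullet> y"])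
  moreover have "continuous_on {-h..} n"
    unfolding n_def using x_cont \<open>\<gamma> + \<mu> - 1 > 0\<close>
    by (intro continuous_on_powr') (auto intro!: continuous_intros)
  note has_real_derivative_weighted_window_integral[OF this \<open>h \<ge> 0\<close> \<open>t \<ge> 0\<close>, of w1 w2]
  ultimately have "((\<lambda>s. V (x s) + V' (x s) \<bullet> P s
        + integral {-h..0} (\<lambda>\<theta>. (w1 + (h + \<theta>) * w2) * n (s + \<theta>)))
      has_real_derivative V' a \<bullet> y + (blinfun_apply (V'' a) y \<bullet> P t + V' a \<bullet> P')
        + ((w1 + h * w2) * n t - w1 * n (t - h) - w2 * integral {-h..0} (\<lambda>\<theta>. n (t + \<theta>))))
      (at t within {0..})"
    by (intro DERIV_add)
  moreover have "(\<lambda>s. vfun h f B Q V V' \<gamma> \<mu> w1 w2 \<epsilon> s (state x s)) = (\<lambda>s. V (x s) + V' (x s) \<bullet> P s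
      + integral {-h..0} (\<lambda>\<theta>. (w1 + (h + \<theta>) * w2) * n (s + \<theta>)))"
    by (rule ext) (simp add: vfun_def state_def P_def n_def add.assoc)
  ultimately show ?thesis
    unfolding P_def P'_def n_def a_def b_def by (simp add: algebra_simps)
qed

section \<open>Estimating the derivative near the origin\<close>

lemma powr_le_powr_of_le_one:
  fixes u M e r :: real
  assumes "0 \<le> u" "u \<le> M" "M \<le> 1" "0 \<le> r" "r \<le> e"
  shows "u powr e \<le> M powr r"
proof -
  have "u powr e \<le> M powr e" using assms by (intro powr_mono2) auto
  also have "\<dots> \<le> M powr r" using assms by (intro powr_mono') auto
  finally show ?thesis .
qed

lemma powr_add_le_of_le:
  fixes M \<delta> d K :: real
  assumes "0 \<le> M" "M \<le> \<delta>" "0 \<le> d"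
  shows "M powr (K + d) \<le> \<delta> powr d * M powr K"
proof -
  have "M powr (K + d) = M powr K * M powr d" by (rule powr_add)
  also have "\<dots> \<le> M powr K * \<delta> powr d"
    using assms by (intro mult_left_mono powr_mono2) auto
  finally show ?thesis by (simp add: mult.commute)
qed

lemma powr_max_le_add:
  fixes u v K :: real
  shows "max u v powr K \<le> u powr K + v powr K"
  by (cases "u \<le> v") (auto simp: max_def)

lemma norm_integral_le_integral_mult:
  fixes G :: "real \<Rightarrow> 'a::banach"
  assumes "g integrable_on {lo..hi}" "c \<ge> 0" "\<And>\<theta>. \<theta> \<in> {lo..hi} \<Longrightarrow> c * norm (G \<theta>) \<le> g \<theta>"
  shows "c * norm (integral {lo..hi} G) \<le> integral {lo..hi} g"
proof (cases "(\<lambda>\<theta>. c *\<^sub>R G \<theta>) integrable_on {lo..hi}")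
  case True
  have "norm (integral {lo..hi} (\<lambda>\<theta>. c *\<^sub>R G \<theta>)) \<le> integral {lo..hi} g"
    by (rule Henstock_Kurzweil_Integration.integral_norm_bound_integral[OF True assms(1)])
      (use assms in auto)
  then show ?thesis using \<open>c \<ge> 0\<close> by simp
next
  case False
  have "c * norm (integral {lo..hi} G) = norm (integral {lo..hi} (\<lambda>\<theta>. c *\<^sub>R G \<theta>))"
    using \<open>c \<ge> 0\<close> by simp
  also have "\<dots> = 0" unfolding not_integrable_integral[OF False] by simp
  also have "\<dots> \<le> integral {lo..hi} g"
    using assms by (intro Henstock_Kurzweil_Integration.integral_nonneg)
      (auto intro: order_trans[OF mult_nonneg_nonneg[OF _ norm_ge_zero]])
  finally show ?thesis .
qed

text \<open>The bound on the Hessian is only assumed away from the origin; continuity extends it there.\<close>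

lemma norm_hessian_le:
  fixes V'' :: "real^'n \<Rightarrow> (real^'n) \<Rightarrow>\<^sub>L (real^'n)"
  assumes V''_cont: "continuous_on UNIV V''" and "\<gamma> \<ge> 2" "\<psi> > 0"
    and V''_bound: "\<And>a. a \<noteq> 0 \<Longrightarrow> norm (V'' a) \<le> \<psi> * norm a powr (\<gamma> - 2)"
    and "M > 0" "norm a \<le> M"
  shows "norm (V'' a) \<le> \<psi> * M powr (\<gamma> - 2)"
proof (cases "a = 0")
  case False
  then have "norm (V'' a) \<le> \<psi> * norm a powr (\<gamma> - 2)" by (rule V''_bound)
  also have "\<dots> \<le> \<psi> * M powr (\<gamma> - 2)"
    using assms by (intro mult_left_mono powr_mono2) auto
  finally show ?thesis .
next
  case True
  define e :: "real^'n" where "e = axis undefined 1"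
  have "norm e = 1" unfolding e_def by simp
  have "isCont V'' 0" using V''_cont by (simp add: continuous_on_eq_continuous_at)
  then have "((\<lambda>c::real. V'' (c *\<^sub>R e)) \<longlongrightarrow> V'' 0) (at_right 0)"
    by (intro filterlim_at_split[THEN iffD1, THEN conjunct2] isCont_tendsto_compose[where g=V''])
      (auto intro!: tendsto_eq_intros)
  then have "((\<lambda>c. norm (V'' (c *\<^sub>R e))) \<longlongrightarrow> norm (V'' 0)) (at_right 0)"
    by (rule tendsto_norm)
  moreover have "\<forall>\<^sub>F c in at_right 0. norm (V'' (c *\<^sub>R e)) \<le> \<psi> * M powr (\<gamma> - 2)"
  proof -
    have "\<forall>\<^sub>F c in at_right (0::real). 0 < c \<and> c < M"
      using \<open>M > 0\<close> by (auto simp: eventually_at_right_field intro: exI[of _ M])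
    then show ?thesis
    proof eventually_elim
      case (elim c)
      then have "norm (V'' (c *\<^sub>R e)) \<le> \<psi> * norm (c *\<^sub>R e) powr (\<gamma> - 2)"
        using \<open>norm e = 1\<close> by (intro V''_bound) auto
      also have "\<dots> \<le> \<psi> * M powr (\<gamma> - 2)"
        using elim \<open>norm e = 1\<close> assms by (intro mult_left_mono powr_mono2) auto
      finally show ?case .
    qed
  qed
  ultimately have "norm (V'' 0) \<le> \<psi> * M powr (\<gamma> - 2)"
    by (rule tendsto_upperbound) simp
  then show ?thesis using True by simp
qed

locale small_window =
  fixes h \<mu> \<sigma> \<gamma> m1 m2 \<eta>11 \<eta>12 bh p1 p2 q11 q12 q21 q22 \<beta> \<psi> \<delta> t :: real
    and f Q :: "real^'n \<Rightarrow> real^'n \<Rightarrow> real^'n"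
    and f1 Q1 Q2 :: "real^'n \<Rightarrow> real^'n \<Rightarrow> (real^'n) \<Rightarrow>\<^sub>L (real^'n)"
    and B :: "real \<Rightarrow> real^'n^'n"
    and V' :: "real^'n \<Rightarrow> real^'n" and V'' :: "real^'n \<Rightarrow> (real^'n) \<Rightarrow>\<^sub>L (real^'n)"
    and x :: "real \<Rightarrow> real^'n"
  assumes h_nonneg: "h \<ge> 0"
    and mu_gt: "\<mu> > 1" and sigma_gt: "\<sigma> > 1" and exponent_gap: "2 * min \<mu> \<sigma> - \<mu> - 1 > 0"
    and m_nonneg: "m1 \<ge> 0" "m2 \<ge> 0" "\<eta>11 \<ge> 0" "\<eta>12 \<ge> 0"
    and f_bound: "\<And>a b. norm (f a b) \<le> m1 * norm a powr \<mu> + m2 * norm b powr \<mu>"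
    and f1_bound: "\<And>a b. norm (f1 a b) \<le> \<eta>11 * norm a powr (\<mu> - 1) + \<eta>12 * norm b powr (\<mu> - 1)"
    and bh_nonneg: "bh \<ge> 0" and B_bound: "\<And>s. s \<ge> 0 \<Longrightarrow> onorm ((*v) (B s)) \<le> bh"
    and p_nonneg: "p1 \<ge> 0" "p2 \<ge> 0" "q11 \<ge> 0" "q12 \<ge> 0" "q21 \<ge> 0" "q22 \<ge> 0"
    and Q_bound: "\<And>a b. norm (Q a b) \<le> p1 * norm a powr \<sigma> + p2 * norm b powr \<sigma>"
    and Q1_bound: "\<And>a b. norm (Q1 a b) \<le> q11 * norm a powr (\<sigma> - 1) + q12 * norm b powr (\<sigma> - 1)"
    and Q2_bound: "\<And>a b. norm (Q2 a b) \<le> q21 * norm a powr (\<sigma> - 1) + q22 * norm b powr (\<sigma> - 1)"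
    and V''_cont: "continuous_on UNIV V''" and gamma_ge: "\<gamma> \<ge> 2"
    and beta_pos: "\<beta> > 0" and psi_pos: "\<psi> > 0"
    and V'_bound: "\<And>a. norm (V' a) \<le> \<beta> * norm a powr (\<gamma> - 1)"
    and V''_bound: "\<And>a. a \<noteq> 0 \<Longrightarrow> norm (V'' a) \<le> \<psi> * norm a powr (\<gamma> - 2)"
    and delta: "0 < \<delta>" "\<delta> \<le> 1"
    and t_nonneg: "t \<ge> 0" and x_cont: "continuous_on {-h..} x"
    and x_small: "\<And>\<theta>. \<theta> \<in> {-h..0} \<Longrightarrow> norm (x (t + \<theta>)) \<le> \<delta>"
begin

abbreviation "xt \<equiv> x t"
abbreviation "xh \<equiv> x (t - h)"
abbreviation "xdot \<equiv> f xt xh + B t *v Q xt xh"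
abbreviation "K \<equiv> \<gamma> + \<mu> - 1"
definition "\<rho> = min \<mu> \<sigma>"
abbreviation "gap \<equiv> 2 * \<rho> - \<mu> - 1"
abbreviation "Cf \<equiv> m1 + m2 + bh * (p1 + p2)"
abbreviation "Cg \<equiv> \<eta>11 + \<eta>12 + bh * (q11 + q12)"
definition "M0 = max (norm xt) (norm xh)"
definition "Mw \<theta> = max (norm xt) (max (norm xh) (norm (x (t + \<theta>))))"
abbreviation "window_sum \<equiv> norm xt powr K + norm xh powr K
    + integral {-h..0} (\<lambda>\<theta>. norm (x (t + \<theta>)) powr K)"

lemma rho_bounds: "1 < \<rho>" "\<rho> \<le> \<mu>" "\<rho> \<le> \<sigma>"
  using mu_gt sigma_gt unfolding \<rho>_def by auto

lemma gap_pos: "gap > 0"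
  using exponent_gap unfolding \<rho>_def .

lemma constants_nonneg: "Cf \<ge> 0" "Cg \<ge> 0" "q11 + q12 + q21 + q22 \<ge> 0"
  using m_nonneg p_nonneg bh_nonneg by auto

lemma norm_xt_xh_le: "norm xt \<le> \<delta>" "norm xh \<le> \<delta>"
  using x_small[of 0] x_small[of "-h"] h_nonneg by auto

lemma M0_bounds: "0 \<le> M0" "M0 \<le> \<delta>" "M0 \<le> 1" "norm xt \<le> M0" "norm xh \<le> M0"
  using norm_xt_xh_le delta unfolding M0_def by (auto simp: le_max_iff_disj)

lemma Mw_bounds:
  assumes "\<theta> \<in> {-h..0}"
  shows "M0 \<le> Mw \<theta>" "norm (x (t + \<theta>)) \<le> Mw \<theta>" "Mw \<theta> \<le> \<delta>" "Mw \<theta> \<le> 1" "0 \<le> Mw \<theta>"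
    "norm xt \<le> Mw \<theta>"
  using x_small[OF assms] norm_xt_xh_le delta unfolding M0_def Mw_def by (auto simp: le_max_iff_disj)

lemma window_integrable: "(\<lambda>\<theta>. norm (x (t + \<theta>)) powr K) integrable_on {-h..0}"
proof -
  have "continuous_on {-h..0} (\<lambda>\<theta>. x (t + \<theta>))"
    by (rule continuous_on_compose2[OF x_cont]) (use t_nonneg in \<open>auto intro!: continuous_intros\<close>)
  then show ?thesis
    using gamma_ge mu_gt by (intro integrable_continuous_interval continuous_on_powr' continuous_intros) auto
qed

lemma window_integral_nonneg: "integral {-h..0} (\<lambda>\<theta>. norm (x (t + \<theta>)) powr K) \<ge> 0"
  by (rule Henstock_Kurzweil_Integration.integral_nonneg[OF window_integrable]) simp

lemma powr_M0_le_gap: "M0 powr (K + gap) \<le> \<delta> powr gap * window_sum"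
proof -
  have "M0 powr (K + gap) \<le> \<delta> powr gap * M0 powr K"
    using M0_bounds gap_pos by (intro powr_add_le_of_le) auto
  also have "\<dots> \<le> \<delta> powr gap * window_sum"
    using powr_max_le_add[of "norm xt" "norm xh" K] window_integral_nonneg
    unfolding M0_def by (intro mult_left_mono) auto
  finally show ?thesis .
qed

lemma powr_Mw_le_gap:
  assumes "\<theta> \<in> {-h..0}"
  shows "Mw \<theta> powr (K + gap)
    \<le> \<delta> powr gap * (norm xt powr K + norm xh powr K + norm (x (t + \<theta>)) powr K)"
proof -
  have "Mw \<theta> powr (K + gap) \<le> \<delta> powr gap * Mw \<theta> powr K"
    using Mw_bounds[OF assms] gap_pos by (intro powr_add_le_of_le) auto
  also have "\<dots> \<le> \<delta> powr gap * (norm xt powr K + norm xh powr K + norm (x (t + \<theta>)) powr K)"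
    using powr_max_le_add[of "norm xt" "max (norm xh) (norm (x (t + \<theta>)))" K]
      powr_max_le_add[of "norm xh" "norm (x (t + \<theta>))" K]
    unfolding Mw_def by (intro mult_left_mono) auto
  finally show ?thesis .
qed

lemma norm_window_integral_le:
  fixes G :: "real \<Rightarrow> 'a::banach"
  assumes "c \<ge> 0" "C \<ge> 0"
    and G_le: "\<And>\<theta>. \<theta> \<in> {-h..0} \<Longrightarrow> c * norm (G \<theta>) \<le> C * Mw \<theta> powr (K + gap)"
  shows "c * norm (integral {-h..0} G) \<le> C * \<delta> powr gap * (1 + h) * window_sum"
proof -
  define A where "A = norm xt powr K + norm xh powr K"
  define J where "J = integral {-h..0} (\<lambda>\<theta>. norm (x (t + \<theta>)) powr K)"
  have int: "(\<lambda>\<theta>. C * \<delta> powr gap * A + C * \<delta> powr gap * norm (x (t + \<theta>)) powr K) integrable_on {-h..0}"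
    by (intro integrable_add integrable_const_ivl integrable_on_mult_right window_integrable)
  have "c * norm (integral {-h..0} G)
      \<le> integral {-h..0} (\<lambda>\<theta>. C * \<delta> powr gap * A + C * \<delta> powr gap * norm (x (t + \<theta>)) powr K)"
  proof (rule norm_integral_le_integral_mult[OF int \<open>c \<ge> 0\<close>])
    fix \<theta> assume "\<theta> \<in> {-h..0}"
    from order_trans[OF G_le[OF this] mult_left_mono[OF powr_Mw_le_gap[OF this] \<open>C \<ge> 0\<close>]]
    show "c * norm (G \<theta>) \<le> C * \<delta> powr gap * A + C * \<delta> powr gap * norm (x (t + \<theta>)) powr K"
      unfolding A_def by (simp add: algebra_simps)
  qed
  also have "\<dots> = C * \<delta> powr gap * (h * A + J)"
  proof -
    have "integral {-h..0} (\<lambda>\<theta>. C * \<delta> powr gap * A + C * \<delta> powr gap * norm (x (t + \<theta>)) powr K)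
        = integral {-h..0} (\<lambda>\<theta>. C * \<delta> powr gap * A)
          + integral {-h..0} (\<lambda>\<theta>. C * \<delta> powr gap * norm (x (t + \<theta>)) powr K)"
      by (rule integral_add[OF integrable_const_ivl integrable_on_mult_right[OF window_integrable]])
    then show ?thesis using h_nonneg unfolding J_def by (simp add: algebra_simps)
  qed
  also have "\<dots> \<le> C * \<delta> powr gap * ((1 + h) * (A + J))"
    using \<open>C \<ge> 0\<close> h_nonneg window_integral_nonneg unfolding A_def J_def
    by (intro mult_left_mono) (auto simp: algebra_simps)
  finally show ?thesis unfolding A_def J_def by (simp add: algebra_simps)
qed


lemma powr_norm_le_M0:
  assumes "0 \<le> r" "r \<le> e"
  shows "norm xt powr e \<le> M0 powr r" "norm xh powr e \<le> M0 powr r"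
  using assms M0_bounds by (auto intro!: powr_le_powr_of_le_one)

lemma powr_norm_le_Mw:
  assumes "\<theta> \<in> {-h..0}" "0 \<le> r" "r \<le> e"
  shows "norm xt powr e \<le> Mw \<theta> powr r" "norm (x (t + \<theta>)) powr e \<le> Mw \<theta> powr r"
  using assms Mw_bounds[OF assms(1)] by (auto intro!: powr_le_powr_of_le_one)

lemma norm_B_mult_le: "s \<ge> 0 \<Longrightarrow> norm (B s *v v) \<le> bh * norm v"
  by (intro norm_matrix_vector_mult_le_bound B_bound)

lemma norm_field_le:
  assumes "norm u powr \<mu> \<le> M" "norm v powr \<mu> \<le> M" "norm u powr \<sigma> \<le> M" "norm v powr \<sigma> \<le> M" "s \<ge> 0"
  shows "norm (f u v + B s *v Q u v) \<le> Cf * M"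
proof -
  have "norm (f u v + B s *v Q u v) \<le> norm (f u v) + bh * norm (Q u v)"
    by (rule order_trans[OF norm_triangle_ineq add_left_mono[OF norm_B_mult_le[OF \<open>s \<ge> 0\<close>]]])
  also have "\<dots> \<le> (m1 * M + m2 * M) + bh * (p1 * M + p2 * M)"
    using assms m_nonneg p_nonneg bh_nonneg
    by (intro add_mono mult_left_mono order_trans[OF f_bound] order_trans[OF Q_bound]) auto
  finally show ?thesis by (simp add: algebra_simps)
qed

lemma norm_xdot_le: "norm xdot \<le> Cf * M0 powr \<rho>"
  using rho_bounds t_nonneg by (intro norm_field_le powr_norm_le_M0) auto

lemma norm_window_field_le:
  assumes "\<theta> \<in> {-h..0}"
  shows "norm (f xt (x (t + \<theta>)) + B (t + \<theta> + h) *v Q xt (x (t + \<theta>))) \<le> Cf * Mw \<theta> powr \<rho>"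
  using assms rho_bounds t_nonneg by (intro norm_field_le powr_norm_le_Mw) auto

lemma norm_window_jacobian_le:
  assumes "\<theta> \<in> {-h..0}"
  shows "norm (f1 xt (x (t + \<theta>)) + (matrix_blinfun (B (t + \<theta> + h)) o\<^sub>L Q1 xt (x (t + \<theta>))))
    \<le> Cg * Mw \<theta> powr (\<rho> - 1)"
proof -
  let ?M = "Mw \<theta> powr (\<rho> - 1)"
  have "norm (f1 xt (x (t + \<theta>)) + (matrix_blinfun (B (t + \<theta> + h)) o\<^sub>L Q1 xt (x (t + \<theta>))))
      \<le> norm (f1 xt (x (t + \<theta>))) + norm (matrix_blinfun (B (t + \<theta> + h))) * norm (Q1 xt (x (t + \<theta>)))"
    by (rule order_trans[OF norm_triangle_ineq add_left_mono[OF norm_blinfun_compose]])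
  also have "\<dots> \<le> (\<eta>11 * ?M + \<eta>12 * ?M) + bh * (q11 * ?M + q12 * ?M)"
  proof (intro add_mono mult_mono)
    show "norm (f1 xt (x (t + \<theta>))) \<le> \<eta>11 * ?M + \<eta>12 * ?M"
      using powr_norm_le_Mw[OF assms, of "\<rho> - 1" "\<mu> - 1"] rho_bounds m_nonneg
      by (intro order_trans[OF f1_bound] add_mono mult_left_mono) auto
    show "norm (Q1 xt (x (t + \<theta>))) \<le> q11 * ?M + q12 * ?M"
      using powr_norm_le_Mw[OF assms, of "\<rho> - 1" "\<sigma> - 1"] rho_bounds p_nonneg
      by (intro order_trans[OF Q1_bound] add_mono mult_left_mono) auto
    show "norm (matrix_blinfun (B (t + \<theta> + h))) \<le> bh"
      unfolding norm_matrix_blinfun using B_bound assms t_nonneg by auto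
  qed (use bh_nonneg in auto)
  finally show ?thesis by (simp add: algebra_simps)
qed

lemma norm_V'_le: "norm (V' xt) \<le> \<beta> * M0 powr (\<gamma> - 1)"
  using M0_bounds beta_pos gamma_ge
  by (intro order_trans[OF V'_bound] mult_left_mono powr_mono2) auto

lemma norm_V''_xdot_le: "norm (V'' xt) * norm xdot \<le> \<psi> * Cf * M0 powr (\<gamma> - 2 + \<rho>)"
proof (cases "M0 = 0")
  case True
  then show ?thesis using norm_xdot_le rho_bounds by simp
next
  case False
  then have "norm (V'' xt) \<le> \<psi> * M0 powr (\<gamma> - 2)"
    using M0_bounds by (intro norm_hessian_le[OF V''_cont gamma_ge psi_pos V''_bound]) auto
  then have "norm (V'' xt) * norm xdot \<le> (\<psi> * M0 powr (\<gamma> - 2)) * (Cf * M0 powr \<rho>)"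
    using norm_xdot_le psi_pos constants_nonneg by (intro mult_mono) auto
  also have "\<dots> = \<psi> * Cf * M0 powr (\<gamma> - 2 + \<rho>)"
    by (simp add: powr_add)
  finally show ?thesis .
qed

lemma norm_Q_diag_le: "0 \<le> r \<Longrightarrow> r \<le> \<sigma> \<Longrightarrow> norm (Q xt xt) \<le> (p1 + p2) * M0 powr r"
proof -
  assume "0 \<le> r" "r \<le> \<sigma>"
  then have "norm (Q xt xt) \<le> p1 * M0 powr r + p2 * M0 powr r"
    using powr_norm_le_M0[of r \<sigma>] p_nonneg
    by (intro order_trans[OF Q_bound] add_mono mult_left_mono) auto
  then show ?thesis by (simp add: algebra_simps)
qed

lemma norm_Q'_diag_le:
  "norm (Q1 xt xt) + norm (Q2 xt xt) \<le> (q11 + q12 + q21 + q22) * M0 powr (\<rho> - 1)"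
proof -
  let ?M = "M0 powr (\<rho> - 1)"
  have "norm (Q1 xt xt) + norm (Q2 xt xt) \<le> (q11 * ?M + q12 * ?M) + (q21 * ?M + q22 * ?M)"
    using powr_norm_le_M0[of "\<rho> - 1" "\<sigma> - 1"] rho_bounds p_nonneg
    by (intro add_mono order_trans[OF Q1_bound] order_trans[OF Q2_bound] mult_left_mono) auto
  then show ?thesis by (simp add: algebra_simps)
qed


lemma gap_exponents: "K + gap = (\<gamma> - 1) + \<rho> + (\<rho> - 1)" "K + gap = (\<gamma> - 2 + \<rho>) + \<rho>"
  by simp_all

lemma inner_V'_window_jacobian_le:
  "\<bar>V' xt \<bullet> blinfun_apply (integral {-h..0} (\<lambda>\<theta>. f1 xt (x (t + \<theta>))
      + (matrix_blinfun (B (t + \<theta> + h)) o\<^sub>L Q1 xt (x (t + \<theta>))))) xdot\<bar>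
    \<le> \<beta> * Cf * Cg * \<delta> powr gap * (1 + h) * window_sum"
  (is "\<bar>V' xt \<bullet> blinfun_apply (integral {-h..0} ?G) xdot\<bar> \<le> _")
proof -
  have "\<bar>V' xt \<bullet> blinfun_apply (integral {-h..0} ?G) xdot\<bar>
      \<le> norm (V' xt) * (norm (integral {-h..0} ?G) * norm xdot)"
    by (rule order_trans[OF Cauchy_Schwarz_ineq2 mult_left_mono[OF norm_blinfun norm_ge_zero]])
  also have "\<dots> = (norm (V' xt) * norm xdot) * norm (integral {-h..0} ?G)"
    by simp
  also have "\<dots> \<le> \<beta> * Cf * Cg * \<delta> powr gap * (1 + h) * window_sum"
  proof (rule norm_window_integral_le)
    fix \<theta> assume \<theta>: "\<theta> \<in> {-h..0}"
    have "norm (V' xt) * norm xdot * norm (?G \<theta>)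
        \<le> (\<beta> * M0 powr (\<gamma> - 1)) * (Cf * M0 powr \<rho>) * (Cg * Mw \<theta> powr (\<rho> - 1))"
      using norm_V'_le norm_xdot_le norm_window_jacobian_le[OF \<theta>] beta_pos constants_nonneg
      by (intro mult_mono) auto
    also have "\<dots> \<le> (\<beta> * Mw \<theta> powr (\<gamma> - 1)) * (Cf * Mw \<theta> powr \<rho>) * (Cg * Mw \<theta> powr (\<rho> - 1))"
      using Mw_bounds[OF \<theta>] M0_bounds beta_pos constants_nonneg gamma_ge rho_bounds
      by (intro mult_mono mult_left_mono powr_mono2) auto
    also have "\<dots> = \<beta> * Cf * Cg * Mw \<theta> powr (K + gap)"
      unfolding gap_exponents(1) powr_add by (simp add: algebra_simps)
    finally show "norm (V' xt) * norm xdot * norm (?G \<theta>) \<le> \<beta> * Cf * Cg * Mw \<theta> powr (K + gap)" .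
  qed (use beta_pos constants_nonneg in auto)
  finally show ?thesis .
qed

lemma inner_V''_window_field_le:
  "\<bar>blinfun_apply (V'' xt) xdot \<bullet> integral {-h..0} (\<lambda>\<theta>. f xt (x (t + \<theta>))
      + B (t + \<theta> + h) *v Q xt (x (t + \<theta>)))\<bar>
    \<le> \<psi> * Cf * Cf * \<delta> powr gap * (1 + h) * window_sum"
  (is "\<bar>_ \<bullet> integral {-h..0} ?F\<bar> \<le> _")
proof -
  have "\<bar>blinfun_apply (V'' xt) xdot \<bullet> integral {-h..0} ?F\<bar>
      \<le> (norm (V'' xt) * norm xdot) * norm (integral {-h..0} ?F)"
    by (rule order_trans[OF Cauchy_Schwarz_ineq2 mult_right_mono[OF norm_blinfun norm_ge_zero]])
  also have "\<dots> \<le> \<psi> * Cf * Cf * \<delta> powr gap * (1 + h) * window_sum"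
  proof (rule norm_window_integral_le)
    fix \<theta> assume \<theta>: "\<theta> \<in> {-h..0}"
    have "norm (V'' xt) * norm xdot * norm (?F \<theta>)
        \<le> (\<psi> * Cf * M0 powr (\<gamma> - 2 + \<rho>)) * (Cf * Mw \<theta> powr \<rho>)"
      by (rule mult_mono[OF norm_V''_xdot_le norm_window_field_le[OF \<theta>]])
        (use psi_pos constants_nonneg in auto)
    also have "\<dots> \<le> (\<psi> * Cf * Mw \<theta> powr (\<gamma> - 2 + \<rho>)) * (Cf * Mw \<theta> powr \<rho>)"
    proof -
      have "M0 powr (\<gamma> - 2 + \<rho>) \<le> Mw \<theta> powr (\<gamma> - 2 + \<rho>)"
        using Mw_bounds[OF \<theta>] M0_bounds gamma_ge rho_bounds by (intro powr_mono2) auto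
      then show ?thesis
        using psi_pos constants_nonneg by (intro mult_right_mono mult_left_mono) auto
    qed
    also have "\<dots> = \<psi> * Cf * Cf * Mw \<theta> powr (K + gap)"
      unfolding gap_exponents(2) powr_add by (simp add: algebra_simps)
    finally show "norm (V'' xt) * norm xdot * norm (?F \<theta>) \<le> \<psi> * Cf * Cf * Mw \<theta> powr (K + gap)" .
  qed (use psi_pos constants_nonneg in auto)
  finally show ?thesis .
qed

lemma inner_V''_kernel_le:
  assumes L_le: "\<And>q. norm (L *v q) \<le> l * norm q" and "l \<ge> 0"
  shows "\<bar>blinfun_apply (V'' xt) xdot \<bullet> (L *v Q xt xt)\<bar> \<le> \<psi> * Cf * l * (p1 + p2) * \<delta> powr gap * window_sum"
proof -
  have "\<bar>blinfun_apply (V'' xt) xdot \<bullet> (L *v Q xt xt)\<bar> \<le> (norm (V'' xt) * norm xdot) * (l * norm (Q xt xt))"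
    by (rule order_trans[OF Cauchy_Schwarz_ineq2 mult_mono[OF norm_blinfun L_le]]) auto
  also have "\<dots> \<le> (\<psi> * Cf * M0 powr (\<gamma> - 2 + \<rho>)) * (l * ((p1 + p2) * M0 powr \<rho>))"
    using norm_Q_diag_le[of \<rho>] rho_bounds \<open>l \<ge> 0\<close> psi_pos constants_nonneg
    by (intro mult_mono[OF norm_V''_xdot_le] mult_left_mono) auto
  also have "\<dots> = \<psi> * Cf * l * (p1 + p2) * M0 powr (K + gap)"
    unfolding gap_exponents(2) powr_add by (simp add: algebra_simps)
  also have "\<dots> \<le> \<psi> * Cf * l * (p1 + p2) * (\<delta> powr gap * window_sum)"
    using powr_M0_le_gap psi_pos constants_nonneg \<open>l \<ge> 0\<close> p_nonneg by (intro mult_left_mono) auto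
  finally show ?thesis by (simp add: algebra_simps)
qed

lemma inner_V'_kernel_jacobian_le:
  assumes L_le: "\<And>q. norm (L *v q) \<le> l * norm q" and "l \<ge> 0"
  shows "\<bar>V' xt \<bullet> (L *v (blinfun_apply (Q1 xt xt) xdot + blinfun_apply (Q2 xt xt) xdot))\<bar>
    \<le> \<beta> * l * (q11 + q12 + q21 + q22) * Cf * \<delta> powr gap * window_sum"
proof -
  have "norm (blinfun_apply (Q1 xt xt) xdot + blinfun_apply (Q2 xt xt) xdot)
      \<le> (norm (Q1 xt xt) + norm (Q2 xt xt)) * norm xdot"
    using norm_triangle_ineq[of "blinfun_apply (Q1 xt xt) xdot" "blinfun_apply (Q2 xt xt) xdot"]
      norm_blinfun[of "Q1 xt xt" xdot] norm_blinfun[of "Q2 xt xt" xdot] by (simp add: algebra_simps)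
  then have "\<bar>V' xt \<bullet> (L *v (blinfun_apply (Q1 xt xt) xdot + blinfun_apply (Q2 xt xt) xdot))\<bar>
      \<le> norm (V' xt) * (l * ((norm (Q1 xt xt) + norm (Q2 xt xt)) * norm xdot))"
    using L_le \<open>l \<ge> 0\<close>
    by (intro order_trans[OF Cauchy_Schwarz_ineq2] mult_left_mono order_trans[OF L_le]) auto
  also have "\<dots> \<le> (\<beta> * M0 powr (\<gamma> - 1))
      * (l * (((q11 + q12 + q21 + q22) * M0 powr (\<rho> - 1)) * (Cf * M0 powr \<rho>)))"
    using norm_V'_le norm_Q'_diag_le norm_xdot_le \<open>l \<ge> 0\<close> beta_pos constants_nonneg
    by (intro mult_mono mult_left_mono) auto
  also have "\<dots> = \<beta> * l * (q11 + q12 + q21 + q22) * Cf * M0 powr (K + gap)"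
    unfolding gap_exponents(1) powr_add by (simp add: algebra_simps)
  also have "\<dots> \<le> \<beta> * l * (q11 + q12 + q21 + q22) * Cf * (\<delta> powr gap * window_sum)"
    using powr_M0_le_gap beta_pos constants_nonneg \<open>l \<ge> 0\<close> by (intro mult_left_mono) auto
  finally show ?thesis by (simp add: algebra_simps)
qed

text \<open>This term has order \<gamma> - 1 + \<sigma>, which is at least K only when \<sigma> \<ge> \<mu>; it gains no
  factor \<delta> powr gap and must be made small through \<omega>.\<close>

lemma inner_V'_scaled_kernel_le:
  assumes E_le: "\<And>q. norm (E *v q) \<le> \<omega> * norm q" and "\<omega> \<ge> 0" and "\<omega> = 0 \<or> \<mu> \<le> \<sigma>"
  shows "\<bar>V' xt \<bullet> (E *v Q xt xt)\<bar> \<le> \<beta> * (p1 + p2) * \<omega> * window_sum"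
proof -
  have "\<bar>V' xt \<bullet> (E *v Q xt xt)\<bar> \<le> (\<beta> * M0 powr (\<gamma> - 1)) * (\<omega> * ((p1 + p2) * M0 powr \<sigma>))"
    using norm_V'_le norm_Q_diag_le[of \<sigma>] sigma_gt \<open>\<omega> \<ge> 0\<close> beta_pos
    by (intro order_trans[OF Cauchy_Schwarz_ineq2] mult_mono order_trans[OF E_le] mult_left_mono) auto
  also have "\<dots> = \<beta> * (p1 + p2) * \<omega> * M0 powr (\<gamma> - 1 + \<sigma>)"
    by (simp add: powr_add mult_ac)
  also have "\<dots> \<le> \<beta> * (p1 + p2) * \<omega> * window_sum"
  proof (cases "\<omega> = 0")
    case False
    with \<open>\<omega> = 0 \<or> \<mu> \<le> \<sigma>\<close> have "M0 powr (\<gamma> - 1 + \<sigma>) \<le> M0 powr K"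
      using M0_bounds by (intro powr_mono') auto
    also have "\<dots> \<le> window_sum"
      using powr_max_le_add[of "norm xt" "norm xh" K] window_integral_nonneg unfolding M0_def by auto
    finally show ?thesis
      using beta_pos p_nonneg \<open>\<omega> \<ge> 0\<close> by (intro mult_left_mono) auto
  qed simp
  finally show ?thesis .
qed


abbreviation "cross_const l \<equiv> (\<beta> * Cf * Cg + \<psi> * Cf * Cf) * (1 + h) + \<psi> * Cf * l * (p1 + p2)
    + \<beta> * l * (q11 + q12 + q21 + q22) * Cf"

text \<open>After the cancellations built into the functional, only V' f(x,x) survives at order K;
  every other term is bounded by the five estimates above.\<close>

lemma derivative_expression_le:
  assumes V_decr: "\<And>a. V' a \<bullet> f a a \<le> - w * norm a powr (\<gamma> + \<mu> - 1)"
    and L_le: "\<And>q. norm (L *v q) \<le> l * norm q" and "l \<ge> 0"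
    and E_le: "\<And>q. norm ((\<epsilon> *\<^sub>R L) *v q) \<le> \<omega> * norm q" and "\<omega> \<ge> 0" "\<omega> = 0 \<or> \<mu> \<le> \<sigma>"
  shows "V' xt \<bullet> xdot
      + blinfun_apply (V'' xt) xdot \<bullet> (integral {-h..0} (\<lambda>\<theta>. f xt (x (t + \<theta>))
          + B (t + \<theta> + h) *v Q xt (x (t + \<theta>))) - L *v Q xt xt)
      + V' xt \<bullet> ((f xt xt + B (t + h) *v Q xt xt) - xdot
            + blinfun_apply (integral {-h..0} (\<lambda>\<theta>. f1 xt (x (t + \<theta>))
                + (matrix_blinfun (B (t + \<theta> + h)) o\<^sub>L Q1 xt (x (t + \<theta>))))) xdot
            - ((B (t + h) - \<epsilon> *\<^sub>R L) *v Q xt xt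
                + L *v (blinfun_apply (Q1 xt xt) xdot + blinfun_apply (Q2 xt xt) xdot)))
      + ((w1 + h * w2) * norm xt powr K - w1 * norm xh powr K
         - w2 * integral {-h..0} (\<lambda>\<theta>. norm (x (t + \<theta>)) powr K))
    \<le> - (w - w1 - h * w2) * norm xt powr K - w1 * norm xh powr K
       - w2 * integral {-h..0} (\<lambda>\<theta>. norm (x (t + \<theta>)) powr K)
       + (cross_const l * \<delta> powr gap + \<beta> * (p1 + p2) * \<omega>) * window_sum"
proof -
  let ?F = "integral {-h..0} (\<lambda>\<theta>. f xt (x (t + \<theta>)) + B (t + \<theta> + h) *v Q xt (x (t + \<theta>)))"
  let ?G = "integral {-h..0} (\<lambda>\<theta>. f1 xt (x (t + \<theta>))
      + (matrix_blinfun (B (t + \<theta> + h)) o\<^sub>L Q1 xt (x (t + \<theta>))))"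
  let ?Q' = "blinfun_apply (Q1 xt xt) xdot + blinfun_apply (Q2 xt xt) xdot"
  have split: "V' xt \<bullet> xdot + blinfun_apply (V'' xt) xdot \<bullet> (?F - L *v Q xt xt)
      + V' xt \<bullet> ((f xt xt + B (t + h) *v Q xt xt) - xdot + blinfun_apply ?G xdot
          - ((B (t + h) - \<epsilon> *\<^sub>R L) *v Q xt xt + L *v ?Q'))
    = V' xt \<bullet> f xt xt + V' xt \<bullet> blinfun_apply ?G xdot + V' xt \<bullet> ((\<epsilon> *\<^sub>R L) *v Q xt xt)
      - V' xt \<bullet> (L *v ?Q') + blinfun_apply (V'' xt) xdot \<bullet> ?F
      - blinfun_apply (V'' xt) xdot \<bullet> (L *v Q xt xt)"
    by (simp add: inner_add_right inner_diff_right matrix_vector_mult_diff_rdistrib)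
  define S where "S = window_sum"
  define A where "A = norm xt powr K"
  define D where "D = \<delta> powr gap"
  note bounds = V_decr[of xt]
    abs_le_D1[OF inner_V'_window_jacobian_le]
    abs_le_D1[OF inner_V'_scaled_kernel_le[OF E_le \<open>\<omega> \<ge> 0\<close> \<open>\<omega> = 0 \<or> \<mu> \<le> \<sigma>\<close>]]
    abs_le_D2[OF inner_V'_kernel_jacobian_le[OF L_le \<open>l \<ge> 0\<close>]]
    abs_le_D1[OF inner_V''_window_field_le]
    abs_le_D2[OF inner_V''_kernel_le[OF L_le \<open>l \<ge> 0\<close>]]
  have "- (w - w1 - h * w2) * A = - w * A + (w1 + h * w2) * A"
    by (simp add: algebra_simps)
  moreover have "(cross_const l * D + \<beta> * (p1 + p2) * \<omega>) * S
      = \<beta> * Cf * Cg * D * (1 + h) * S + \<beta> * (p1 + p2) * \<omega> * S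
        + \<beta> * l * (q11 + q12 + q21 + q22) * Cf * D * S
        + \<psi> * Cf * Cf * D * (1 + h) * S + \<psi> * Cf * l * (p1 + p2) * D * S"
    by (simp add: algebra_simps)
  ultimately show ?thesis
    using bounds[folded S_def A_def D_def]
    by (unfold split, fold S_def, fold A_def D_def) linarith
qed

end

section \<open>The main estimate\<close>

lemma exists_small_powr:
  fixes C c d :: real
  assumes "C \<ge> 0" "c > 0" "d > 0"
  obtains \<delta> where "0 < \<delta>" "\<delta> \<le> 1" "C * \<delta> powr d \<le> c"
proof
  define \<delta> where "\<delta> = min 1 ((c / (C + 1)) powr (1 / d))"
  show "0 < \<delta>" "\<delta> \<le> 1" unfolding \<delta>_def using assms by auto
  have "\<delta> powr d \<le> ((c / (C + 1)) powr (1 / d)) powr d"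
    unfolding \<delta>_def using assms by (intro powr_mono2) auto
  also have "\<dots> = c / (C + 1)" using assms by (simp add: powr_powr)
  finally have "C * \<delta> powr d \<le> C * (c / (C + 1))"
    using assms by (intro mult_left_mono) auto
  also have "\<dots> \<le> c" using assms by (simp add: field_simps)
  finally show "C * \<delta> powr d \<le> c" .
qed

lemma mult_divide_add_one_le:
  fixes a c :: real
  assumes "a \<ge> 0" "c \<ge> 0"
  shows "a * (c / (a + 1)) \<le> c"
proof -
  have "a * (c / (a + 1)) = c * (a / (a + 1))" by simp
  also have "\<dots> \<le> c" using assms by (intro mult_left_le) auto
  finally show ?thesis .
qed

lemma absorb_perturbation:
  fixes a b c \<eta> A Bn J :: real
  assumes "\<eta> \<le> min a (min b c) / 2" "A \<ge> 0" "Bn \<ge> 0" "J \<ge> 0"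
  shows "- a * A - b * Bn - c * J + \<eta> * (A + Bn + J) \<le> - (a / 2) * A - (b / 2) * Bn - (c / 2) * J"
proof -
  have "\<eta> \<le> a / 2" "\<eta> \<le> b / 2" "\<eta> \<le> c / 2"
    using assms(1) by auto
  with assms(2-4) have "\<eta> * A \<le> (a / 2) * A" "\<eta> * Bn \<le> (b / 2) * Bn" "\<eta> * J \<le> (c / 2) * J"
    by (simp_all only: mult_right_mono)
  then show ?thesis by (simp add: algebra_simps)
qed

lemma at_within_atLeast_nontrivial: "t \<ge> c \<Longrightarrow> at t within {c..} \<noteq> (bot :: real filter)"
proof -
  assume "t \<ge> c"
  then have "at_right t \<le> at t within {c..}" by (intro at_le) auto
  then show ?thesis by (metis bot.extremum_unique trivial_limit_at_right_real)
qed

lemma derivative_estimateI: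
  assumes "\<delta> > 0" "c0 > 0" "c1 > 0" "c2 > 0"
    and "\<And>x t D. is_solution h f B Q x \<Longrightarrow> t \<ge> 0 \<Longrightarrow> \<forall>\<theta>\<in>{-h..0}. norm (x (t + \<theta>)) \<le> \<delta> \<Longrightarrow>
          ((\<lambda>s. vfun h f B Q V V' \<gamma> \<mu> w1 w2 \<epsilon> s (state x s)) has_real_derivative D) (at t within {0..})
          \<Longrightarrow> D \<le> - c0 * norm (x t) powr (\<gamma> + \<mu> - 1) - c1 * norm (x (t - h)) powr (\<gamma> + \<mu> - 1)
                  - c2 * integral {-h..0} (\<lambda>\<theta>. norm (x (t + \<theta>)) powr (\<gamma> + \<mu> - 1))"
  shows "derivative_estimate h f B Q V V' \<gamma> \<mu> w1 w2 \<epsilon>"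
  unfolding derivative_estimate_def
  by (rule exI[of _ \<delta>], rule conjI[OF assms(1)], rule exI[of _ c0], rule conjI[OF assms(2)],
      rule exI[of _ c1], rule conjI[OF assms(3)], rule exI[of _ c2], rule conjI[OF assms(4)])
    (use assms(5) in blast)

locale delay_system =
  fixes h \<mu> \<sigma> \<gamma> m1 m2 \<eta>11 \<eta>12 bh p1 p2 q11 q12 q21 q22 w \<beta> \<psi> w1 w2 :: real
    and f Q :: "real^'n \<Rightarrow> real^'n \<Rightarrow> real^'n"
    and f1 f2 Q1 Q2 :: "real^'n \<Rightarrow> real^'n \<Rightarrow> (real^'n) \<Rightarrow>\<^sub>L (real^'n)"
    and B :: "real \<Rightarrow> real^'n^'n"
    and V :: "real^'n \<Rightarrow> real" and V' :: "real^'n \<Rightarrow> real^'n"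
    and V'' :: "real^'n \<Rightarrow> (real^'n) \<Rightarrow>\<^sub>L (real^'n)"
  assumes h_pos: "h > 0"
    and f_deriv: "\<And>a b. ((\<lambda>p. f (fst p) (snd p)) has_derivative
                     (\<lambda>u. blinfun_apply (f1 a b) (fst u) + blinfun_apply (f2 a b) (snd u))) (at (a, b))"
    and f1_cont: "continuous_on UNIV (\<lambda>p. f1 (fst p) (snd p))"
    and mu_gt: "\<mu> > 1"
    and m_nonneg: "m1 \<ge> 0" "m2 \<ge> 0" "\<eta>11 \<ge> 0" "\<eta>12 \<ge> 0"
    and f_bound: "\<And>a b. norm (f a b) \<le> m1 * norm a powr \<mu> + m2 * norm b powr \<mu>"
    and f1_bound: "\<And>a b. norm (f1 a b) \<le> \<eta>11 * norm a powr (\<mu> - 1) + \<eta>12 * norm b powr (\<mu> - 1)"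
    and B_cont: "continuous_on {0..} B"
    and B_bound: "\<And>t. t \<ge> 0 \<Longrightarrow> onorm ((*v) (B t)) \<le> bh"
    and Q_deriv: "\<And>a b. ((\<lambda>p. Q (fst p) (snd p)) has_derivative
                     (\<lambda>u. blinfun_apply (Q1 a b) (fst u) + blinfun_apply (Q2 a b) (snd u))) (at (a, b))"
    and Q1_cont: "continuous_on UNIV (\<lambda>p. Q1 (fst p) (snd p))"
    and sigma_gt: "\<sigma> > 1"
    and p_nonneg: "p1 \<ge> 0" "p2 \<ge> 0" "q11 \<ge> 0" "q12 \<ge> 0" "q21 \<ge> 0" "q22 \<ge> 0"
    and Q_bound: "\<And>a b. norm (Q a b) \<le> p1 * norm a powr \<sigma> + p2 * norm b powr \<sigma>"
    and Q1_bound: "\<And>a b. norm (Q1 a b) \<le> q11 * norm a powr (\<sigma> - 1) + q12 * norm b powr (\<sigma> - 1)"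
    and Q2_bound: "\<And>a b. norm (Q2 a b) \<le> q21 * norm a powr (\<sigma> - 1) + q22 * norm b powr (\<sigma> - 1)"
    and V_deriv: "\<And>a. (V has_derivative (\<lambda>u. V' a \<bullet> u)) (at a)"
    and V'_deriv: "\<And>a. (V' has_derivative blinfun_apply (V'' a)) (at a)"
    and V''_cont: "continuous_on UNIV V''"
    and gamma_ge: "\<gamma> \<ge> 2"
    and beta_pos: "\<beta> > 0" and psi_pos: "\<psi> > 0"
    and V_decr: "\<And>a. V' a \<bullet> f a a \<le> - w * norm a powr (\<gamma> + \<mu> - 1)"
    and V'_bound: "\<And>a. norm (V' a) \<le> \<beta> * norm a powr (\<gamma> - 1)"
    and V''_bound: "\<And>a. a \<noteq> 0 \<Longrightarrow> norm (V'' a) \<le> \<psi> * norm a powr (\<gamma> - 2)"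
    and w12_pos: "w1 > 0" "w2 > 0"
    and w0_pos: "w - w1 - h * w2 > 0"
begin

abbreviation "w_min \<equiv> min (w - w1 - h * w2) (min w1 w2)"

lemma bh_nonneg: "bh \<ge> 0"
  using B_bound[of 0] onorm_pos_le[OF matrix_vector_mul_bounded_linear, of "B 0"] by linarith

lemma derivative_estimate_if_kernel_bounds:
  assumes gap: "2 * min \<mu> \<sigma> - \<mu> - 1 > 0"
    and L_le: "\<And>t q. t \<ge> 0 \<Longrightarrow> norm (Lmat h B \<epsilon> t *v q) \<le> l * norm q" and "l \<ge> 0"
    and E_le: "\<And>t q. t \<ge> 0 \<Longrightarrow> norm ((\<epsilon> *\<^sub>R Lmat h B \<epsilon> t) *v q) \<le> \<omega> * norm q"
    and "\<omega> \<ge> 0" "\<omega> = 0 \<or> \<mu> \<le> \<sigma>"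
    and \<omega>_small: "\<beta> * (p1 + p2) * \<omega> \<le> w_min / 4"
  shows "derivative_estimate h f B Q V V' \<gamma> \<mu> w1 w2 \<epsilon>"
proof -
  let ?K = "\<gamma> + \<mu> - 1"
  let ?Cf = "m1 + m2 + bh * (p1 + p2)"
  define C where "C = (\<beta> * ?Cf * (\<eta>11 + \<eta>12 + bh * (q11 + q12)) + \<psi> * ?Cf * ?Cf) * (1 + h)
      + \<psi> * ?Cf * l * (p1 + p2) + \<beta> * l * (q11 + q12 + q21 + q22) * ?Cf"
  have "C \<ge> 0"
    unfolding C_def using beta_pos psi_pos m_nonneg p_nonneg bh_nonneg \<open>l \<ge> 0\<close> h_pos
    by (intro add_nonneg_nonneg mult_nonneg_nonneg) auto
  moreover have "w_min > 0" using w0_pos w12_pos by auto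
  ultimately obtain \<delta> where \<delta>: "0 < \<delta>" "\<delta> \<le> 1" "C * \<delta> powr (2 * min \<mu> \<sigma> - \<mu> - 1) \<le> w_min / 4"
    using exists_small_powr[of C "w_min / 4" "2 * min \<mu> \<sigma> - \<mu> - 1"] gap by auto
  have estimate: "D \<le> - ((w - w1 - h * w2) / 2) * norm (x t) powr ?K - (w1 / 2) * norm (x (t - h)) powr ?K
      - (w2 / 2) * integral {-h..0} (\<lambda>\<theta>. norm (x (t + \<theta>)) powr ?K)"
    if sol: "is_solution h f B Q x" and "t \<ge> 0" and small: "\<forall>\<theta>\<in>{-h..0}. norm (x (t + \<theta>)) \<le> \<delta>"
      and D: "((\<lambda>s. vfun h f B Q V V' \<gamma> \<mu> w1 w2 \<epsilon> s (state x s)) has_real_derivative D) (at t within {0..})"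
    for x t D
  proof -
    have x_cont: "continuous_on {-h..} x" using sol unfolding is_solution_def by simp
    have "h \<ge> 0" using h_pos by simp
    moreover have "\<And>\<theta>. \<theta> \<in> {-h..0} \<Longrightarrow> norm (x (t + \<theta>)) \<le> \<delta>" using small by blast
    ultimately interpret W: small_window h \<mu> \<sigma> \<gamma> m1 m2 \<eta>11 \<eta>12 bh p1 p2 q11 q12 q21 q22 \<beta> \<psi> \<delta> t
        f Q f1 Q1 Q2 B V' V'' x
      using mu_gt sigma_gt gap m_nonneg f_bound f1_bound bh_nonneg B_bound p_nonneg Q_bound
        Q1_bound Q2_bound V''_cont gamma_ge beta_pos psi_pos V'_bound V''_bound \<delta>(1,2) \<open>t \<ge> 0\<close> x_cont
      by unfold_locales assumption+
    let ?J = "integral {-h..0} (\<lambda>\<theta>. norm (x (t + \<theta>)) powr ?K)"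
    have "\<gamma> + \<mu> - 1 > 0" using gamma_ge mu_gt by simp
    note deriv = vfun_has_real_derivative[OF f_deriv f1_cont Q_deriv Q1_cont B_cont V_deriv V'_deriv sol
        less_imp_le[OF h_pos] \<open>t \<ge> 0\<close> this, of w1 w2 \<epsilon>]
    note D_eq = vector_derivative_unique_within[OF at_within_atLeast_nontrivial[OF \<open>t \<ge> 0\<close>]
        D[unfolded has_real_derivative_iff_has_vector_derivative]
        deriv[unfolded has_real_derivative_iff_has_vector_derivative]]
    have "D \<le> - (w - w1 - h * w2) * norm (x t) powr ?K - w1 * norm (x (t - h)) powr ?K - w2 * ?J
        + (C * \<delta> powr (2 * min \<mu> \<sigma> - \<mu> - 1) + \<beta> * (p1 + p2) * \<omega>) * W.window_sum"
      using W.derivative_expression_le[OF V_decr L_le[OF \<open>t \<ge> 0\<close>] \<open>l \<ge> 0\<close> E_le[OF \<open>t \<ge> 0\<close>]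
          \<open>\<omega> \<ge> 0\<close> \<open>\<omega> = 0 \<or> \<mu> \<le> \<sigma>\<close>, of w1 w2]
      unfolding C_def W.\<rho>_def by (simp only: D_eq)
    also have "\<dots> \<le> - ((w - w1 - h * w2) / 2) * norm (x t) powr ?K - (w1 / 2) * norm (x (t - h)) powr ?K
        - (w2 / 2) * ?J"
      using \<delta>(3) \<omega>_small W.window_integral_nonneg by (intro absorb_perturbation) auto
    finally show ?thesis .
  qed
  show ?thesis
    by (rule derivative_estimateI[OF \<delta>(1) _ _ _ estimate]) (use w0_pos w12_pos in auto)
qed

lemma derivative_estimate_bounded_primitive:
  assumes K: "\<And>t. t \<ge> 0 \<Longrightarrow> onorm ((*v) (integral {0..t} B)) \<le> K" and "\<sigma> > (\<mu> + 1) / 2"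
  shows "derivative_estimate h f B Q V V' \<gamma> \<mu> w1 w2 0"
proof -
  have "2 * min \<mu> \<sigma> - \<mu> - 1 > 0" using assms(2) mu_gt by (auto simp: min_def)
  moreover have "K \<ge> 0"
    using K[of 0] onorm_pos_le[OF matrix_vector_mul_bounded_linear, of "integral {0..0} B"] by linarith
  ultimately show ?thesis
    using norm_Lmat_mult_le_primitive_bound[OF K] h_pos w0_pos w12_pos
    by (intro derivative_estimate_if_kernel_bounds[where l = K and \<omega> = 0]) auto
qed

lemma derivative_estimate_small_average:
  assumes average: "\<And>e. e > 0 \<Longrightarrow>
      \<exists>T0>0. \<forall>T\<ge>T0. \<forall>t\<ge>0. onorm ((*v) ((1 / T) *\<^sub>R integral {t..t + T} B)) \<le> e"
    and "\<sigma> \<ge> \<mu>"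
  shows "\<exists>\<epsilon>0>0. \<forall>\<epsilon>. 0 < \<epsilon> \<and> \<epsilon> < \<epsilon>0 \<longrightarrow> derivative_estimate h f B Q V V' \<gamma> \<mu> w1 w2 \<epsilon>"
proof -
  have gap: "2 * min \<mu> \<sigma> - \<mu> - 1 > 0" using \<open>\<sigma> \<ge> \<mu>\<close> mu_gt by (auto simp: min_def)
  define \<omega> where "\<omega> = (w_min / 4) / (\<beta> * (p1 + p2) + 1)"
  have "\<beta> * (p1 + p2) \<ge> 0" "w_min > 0" using beta_pos p_nonneg w0_pos w12_pos by auto
  then have "\<omega> > 0" unfolding \<omega>_def by (intro divide_pos_pos) auto
  have \<omega>_small: "\<beta> * (p1 + p2) * \<omega> \<le> w_min / 4"
    unfolding \<omega>_def by (rule mult_divide_add_one_le) (use \<open>\<beta> * (p1 + p2) \<ge> 0\<close> \<open>w_min > 0\<close> in auto)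
  obtain T where "T > 0" and T: "\<And>t. t \<ge> 0 \<Longrightarrow> onorm ((*v) ((1 / T) *\<^sub>R integral {t..t + T} B)) \<le> \<omega> / 2"
    using average[of "\<omega> / 2"] \<open>\<omega> > 0\<close> by fastforce
  define \<epsilon>0 where "\<epsilon>0 = (\<omega> / 2) / (3 * bh * T + 1)"
  have "3 * bh * T \<ge> 0" using bh_nonneg \<open>T > 0\<close> by simp
  then have "\<epsilon>0 > 0" unfolding \<epsilon>0_def using \<open>\<omega> > 0\<close> by (intro divide_pos_pos) linarith+
  have "3 * bh * T * \<epsilon>0 \<le> \<omega> / 2"
    unfolding \<epsilon>0_def by (rule mult_divide_add_one_le) (use \<open>3 * bh * T \<ge> 0\<close> \<open>\<omega> > 0\<close> in auto)
  have estimate: "derivative_estimate h f B Q V V' \<gamma> \<mu> w1 w2 \<epsilon>" if "0 < \<epsilon>" "\<epsilon> < \<epsilon>0" for \<epsilon>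
  proof (rule derivative_estimate_if_kernel_bounds[OF gap _ _ _ _ _ \<omega>_small])
    show "norm (Lmat h B \<epsilon> t *v q) \<le> bh / \<epsilon> * norm q" if "t \<ge> 0" for t q
      using that h_pos \<open>0 < \<epsilon>\<close> by (intro norm_Lmat_mult_le[OF B_cont B_bound]) auto
    have "3 * bh * T * \<epsilon> \<le> 3 * bh * T * \<epsilon>0"
      using that \<open>3 * bh * T \<ge> 0\<close> by (intro mult_left_mono) auto
    with \<open>3 * bh * T * \<epsilon>0 \<le> \<omega> / 2\<close>
    have "(\<omega> / 2 + 3 * \<epsilon> * bh * T) * norm q \<le> \<omega> * norm q" for q
      by (intro mult_right_mono) (auto simp: mult_ac)
    then show "norm ((\<epsilon> *\<^sub>R Lmat h B \<epsilon> t) *v q) \<le> \<omega> * norm q" if "t \<ge> 0" for t q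
      using norm_eps_Lmat_mult_le_average[OF B_cont B_bound \<open>T > 0\<close> T \<open>0 < \<epsilon>\<close>, of t h q] that h_pos
      by (meson order_trans less_imp_le add_nonneg_nonneg)
  qed (use \<open>0 < \<epsilon>\<close> bh_nonneg \<open>\<omega> > 0\<close> \<open>\<sigma> \<ge> \<mu>\<close> in auto)
  show ?thesis using \<open>\<epsilon>0 > 0\<close> estimate by blast
qed

end

theorem lemma1:
  fixes h \<mu> \<sigma> \<gamma> m1 m2 \<eta>11 \<eta>12 bh p1 p2 q11 q12 q21 q22 w \<alpha>0 \<alpha>1 \<beta> \<psi> w1 w2 :: real
    and f Q :: "real^'n \<Rightarrow> real^'n \<Rightarrow> real^'n"
    and f1 f2 Q1 Q2 :: "real^'n \<Rightarrow> real^'n \<Rightarrow> (real^'n) \<Rightarrow>\<^sub>L (real^'n)"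
    and B :: "real \<Rightarrow> real^'n^'n"
    and V :: "real^'n \<Rightarrow> real" and V' :: "real^'n \<Rightarrow> real^'n"
    and V'' :: "real^'n \<Rightarrow> (real^'n) \<Rightarrow>\<^sub>L (real^'n)"
  assumes h_pos: "h > 0"
    \<comment> \<open>(i) f is C^1 with partial derivatives f1, f2, homogeneous of degree mu > 1\<close>
    and f_deriv: "\<And>a b. ((\<lambda>p. f (fst p) (snd p)) has_derivative
                     (\<lambda>u. blinfun_apply (f1 a b) (fst u) + blinfun_apply (f2 a b) (snd u))) (at (a, b))"
    and f1_cont: "continuous_on UNIV (\<lambda>p. f1 (fst p) (snd p))"
    and f2_cont: "continuous_on UNIV (\<lambda>p. f2 (fst p) (snd p))"
    and mu_gt: "\<mu> > 1"
    and f_hom: "\<And>c a b. c > 0 \<Longrightarrow> f (c *\<^sub>R a) (c *\<^sub>R b) = c powr \<mu> *\<^sub>R f a b"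
    and m_nonneg: "m1 \<ge> 0" "m2 \<ge> 0" "\<eta>11 \<ge> 0" "\<eta>12 \<ge> 0"
    and f_bound: "\<And>a b. norm (f a b) \<le> m1 * norm a powr \<mu> + m2 * norm b powr \<mu>"
    and f1_bound: "\<And>a b. norm (f1 a b) \<le> \<eta>11 * norm a powr (\<mu> - 1) + \<eta>12 * norm b powr (\<mu> - 1)"
    \<comment> \<open>(ii) B continuous and bounded in operator norm\<close>
    and B_cont: "continuous_on {0..} B"
    and B_bound: "\<And>t. t \<ge> 0 \<Longrightarrow> onorm ((*v) (B t)) \<le> bh"
    \<comment> \<open>(iii) Q is C^1 with partial derivatives Q1, Q2 and the growth bounds\<close>
    and Q_deriv: "\<And>a b. ((\<lambda>p. Q (fst p) (snd p)) has_derivative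
                     (\<lambda>u. blinfun_apply (Q1 a b) (fst u) + blinfun_apply (Q2 a b) (snd u))) (at (a, b))"
    and Q1_cont: "continuous_on UNIV (\<lambda>p. Q1 (fst p) (snd p))"
    and Q2_cont: "continuous_on UNIV (\<lambda>p. Q2 (fst p) (snd p))"
    and sigma_gt: "\<sigma> > 1"
    and p_nonneg: "p1 \<ge> 0" "p2 \<ge> 0" "q11 \<ge> 0" "q12 \<ge> 0" "q21 \<ge> 0" "q22 \<ge> 0"
    and Q_bound: "\<And>a b. norm (Q a b) \<le> p1 * norm a powr \<sigma> + p2 * norm b powr \<sigma>"
    and Q1_bound: "\<And>a b. norm (Q1 a b) \<le> q11 * norm a powr (\<sigma> - 1) + q12 * norm b powr (\<sigma> - 1)"
    and Q2_bound: "\<And>a b. norm (Q2 a b) \<le> q21 * norm a powr (\<sigma> - 1) + q22 * norm b powr (\<sigma> - 1)"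
    \<comment> \<open>(iv) Lyapunov function V: C^2 (gradient V', Hessian V''), homogeneous of degree gamma \<ge> 2\<close>
    and V_deriv: "\<And>a. (V has_derivative (\<lambda>u. V' a \<bullet> u)) (at a)"
    and V'_deriv: "\<And>a. (V' has_derivative blinfun_apply (V'' a)) (at a)"
    and V''_cont: "continuous_on UNIV V''"
    and gamma_ge: "\<gamma> \<ge> 2"
    and V_hom: "\<And>c a. c > 0 \<Longrightarrow> V (c *\<^sub>R a) = c powr \<gamma> * V a"
    and V_posdef: "V 0 = 0" "\<And>a. a \<noteq> 0 \<Longrightarrow> V a > 0"
    and consts_pos: "w > 0" "\<alpha>0 > 0" "\<alpha>1 > 0" "\<beta> > 0" "\<psi> > 0"
    and V_decr: "\<And>a. V' a \<bullet> f a a \<le> - w * norm a powr (\<gamma> + \<mu> - 1)"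
    and V_bounds: "\<And>a. \<alpha>0 * norm a powr \<gamma> \<le> V a" "\<And>a. V a \<le> \<alpha>1 * norm a powr \<gamma>"
    and V'_bound: "\<And>a. norm (V' a) \<le> \<beta> * norm a powr (\<gamma> - 1)"
    and V''_bound: "\<And>a. a \<noteq> 0 \<Longrightarrow> norm (V'' a) \<le> \<psi> * norm a powr (\<gamma> - 2)"
    \<comment> \<open>weights of the functional\<close>
    and w12_pos: "w1 > 0" "w2 > 0"
    and w0_pos: "w - w1 - h * w2 > 0"
  shows "((\<exists>K. \<forall>t\<ge>0. onorm ((*v) (integral {0..t} B)) \<le> K) \<and> \<sigma> > (\<mu> + 1) / 2
            \<longrightarrow> derivative_estimate h f B Q V V' \<gamma> \<mu> w1 w2 0)
       \<and> ((\<forall>e>0. \<exists>T0>0. \<forall>T\<ge>T0. \<forall>t\<ge>0. onorm ((*v) ((1 / T) *\<^sub>R integral {t..t + T} B)) \<le> e)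
            \<and> \<sigma> \<ge> \<mu>
            \<longrightarrow> (\<exists>\<epsilon>0>0. \<forall>\<epsilon>. 0 < \<epsilon> \<and> \<epsilon> < \<epsilon>0
                   \<longrightarrow> derivative_estimate h f B Q V V' \<gamma> \<mu> w1 w2 \<epsilon>))"
proof -
  interpret delay_system h \<mu> \<sigma> \<gamma> m1 m2 \<eta>11 \<eta>12 bh p1 p2 q11 q12 q21 q22 w \<beta> \<psi> w1 w2
      f Q f1 f2 Q1 Q2 B V V' V''
    by unfold_locales (fact assms)+
  show ?thesis
    using derivative_estimate_bounded_primitive derivative_estimate_small_average by blast
qed

end
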